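(* Let $q$ be a prime power and let $M(x)\in\mathbb{F}_q[x]$ be a monic self-reciprocal polynomial of degree $2m$ with $M(0)=1$ of the form $M(x)=(x-1)^2g_1(x)\cdots g_{r-1}(x)$, where the $g_i$ are pairwise different monic irreducible polynomials, none equal to $x\pm1$. Let $M_t(x)=M(x)+tx^m\in\mathbb{F}_q(t)[x]$ and let $H$ be its Galois group over $\mathbb{F}_q(t)$. Then $H$ contains all transpositions on the roots of $M_t$ (i.e., for each root $\alpha$, the permutation interchanging $\alpha$ and $\alpha^{-1}$ and fixing all other roots), and hence $H$ contains a normal elementary abelian $2$-subgroup $N$ of order $2^m$.
   Context: A monic polynomial $g$ of degree $d$ with $g(0)\ne0$ is self-reciprocal if $g(x)=x^dg(0)^{-1}g(x^{-1})$. $M_t$ is irreducible and self-reciprocal, so its roots come in $m$ pairs $\{\alpha_i,\alpha_i^{-1}\}$; $N$ is the kernel of the action of $H$ on these $m$ pairs. *)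

theory Defs
  imports "HOL-Computational_Algebra.Computational_Algebra"
          "HOL-Computational_Algebra.Polynomial_Factorial"
          "HOL-Algebra.Coset"
begin

definition is_field_hom :: "('a::field \<Rightarrow> 'b::field) \<Rightarrow> bool" where
  "is_field_hom f \<longleftrightarrow> f 0 = 0 \<and> f 1 = 1 \<and>
     (\<forall>x y. f (x + y) = f x + f y) \<and> (\<forall>x y. f (x * y) = f x * f y)"

definition self_reciprocal :: "'a::field poly \<Rightarrow> bool" where
  "self_reciprocal g \<longleftrightarrow> lead_coeff g = 1 \<and> poly g 0 \<noteq> 0 \<and>
     g = smult (inverse (poly g 0)) (reflect_poly g)"

definition splits :: "'a::field poly \<Rightarrow> bool" where
  "splits p \<longleftrightarrow> (\<exists>A. p = smult (lead_coeff p) (\<Prod>a\<in>#A. [:-a, 1:]))"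

definition is_subfield :: "'a::field set \<Rightarrow> bool" where
  "is_subfield S \<longleftrightarrow> 0 \<in> S \<and> 1 \<in> S \<and> (\<forall>x\<in>S. \<forall>y\<in>S. x + y \<in> S \<and> x * y \<in> S) \<and>
     (\<forall>x\<in>S. - x \<in> S \<and> inverse x \<in> S)"

definition is_splitting_field :: "('k::field \<Rightarrow> 'l::field) \<Rightarrow> 'k poly \<Rightarrow> bool" where
  "is_splitting_field \<phi> p \<longleftrightarrow> is_field_hom \<phi> \<and> splits (map_poly \<phi> p) \<and>
     (\<forall>S. is_subfield S \<and> range \<phi> \<subseteq> S \<and> {x. poly (map_poly \<phi> p) x = 0} \<subseteq> S \<longrightarrow> S = UNIV)"

definition galois_group :: "('k::field \<Rightarrow> 'l::field) \<Rightarrow> ('l \<Rightarrow> 'l) monoid" where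
  "galois_group \<phi> = \<lparr> carrier = {\<sigma>. bij \<sigma> \<and> is_field_hom \<sigma> \<and> \<sigma> \<circ> \<phi> = \<phi>},
                       mult = (\<circ>), one = id \<rparr>"

definition tvar :: "'a::field poly fract" where
  "tvar = to_fract [:0, 1:]"

definition const_lift :: "'a::field poly \<Rightarrow> 'a poly fract poly" where
  "const_lift M = map_poly (\<lambda>c. to_fract [:c:]) M"

definition Mt :: "'a::field poly \<Rightarrow> nat \<Rightarrow> 'a poly fract poly" where
  "Mt M m = const_lift M + monom tvar m"

end

theory Submission
  imports Defs "Jordan_Normal_Form.Char_Poly"
begin

text \<open>Write \<open>k\<close> for the finite constant field. Since \<open>M\<close> is palindromic,
  \<open>M(x) = x\<^sup>m P(x + 1/x)\<close> with \<open>P(v) = (v - 2) Q(v)\<close>, so a root \<open>\<alpha>\<close> of \<open>M\<^sub>t\<close> gives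
  \<open>t = -P(u)\<close> for \<open>u = \<alpha> + 1/\<alpha>\<close>, which is transcendental over \<open>k\<close>. Let \<open>R\<close> be the ring
  generated over \<open>k[u]\<close> by the roots other than \<open>\<alpha>\<close> and \<open>1/\<alpha>\<close>; it is integral over \<open>k[u]\<close>.
  These roots reduce modulo \<open>u - 2\<close> to roots of the squarefree polynomial \<open>g\<^sub>1 \<dots> g\<^sub>r\<^sub>-\<^sub>1\<close>,
  which divides \<open>x\<^sup>s - x\<close> for some power \<open>s\<close> of the characteristic. Hence \<open>a\<^sup>s \<equiv> a\<close> modulo
  \<open>u - 2\<close> for all \<open>a \<in> R\<close>, so \<open>u - 2\<close> is unramified in \<open>E = Frac R\<close>. But \<open>y = \<alpha> - 1\<close>
  satisfies the Eisenstein equation \<open>y\<^sup>2 = (u - 2) (y + 1)\<close>, so \<open>\<alpha> \<notin> E\<close>. The splitting field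
  is therefore the quadratic extension \<open>E(\<alpha>)\<close>, whose conjugation is the required transposition.
  The transpositions generate the kernel of the action on the pairs \<open>{\<alpha>, 1/\<alpha>}\<close>, and there are
  \<open>m\<close> pairs because \<open>M\<^sub>t\<close> is separable.\<close>

subsection \<open>Subrings and integral elements\<close>

text \<open>Closure under differences yields zero, negatives and sums, which keeps later subring
  checks to three conditions.\<close>

definition is_subring :: "'a::comm_ring_1 set \<Rightarrow> bool" where
  "is_subring S \<longleftrightarrow> 1 \<in> S \<and> (\<forall>x\<in>S. \<forall>y\<in>S. x - y \<in> S \<and> x * y \<in> S)"

lemma is_subringI:
  assumes "1 \<in> S" "\<And>x y. x \<in> S \<Longrightarrow> y \<in> S \<Longrightarrow> x - y \<in> S" "\<And>x y. x \<in> S \<Longrightarrow> y \<in> S \<Longrightarrow> x * y \<in> S"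
  shows "is_subring S"
  using assms by (auto simp: is_subring_def)

context
  fixes S :: "'a::comm_ring_1 set"
  assumes S: "is_subring S"
begin

lemma subring_one: "1 \<in> S"
  using S by (simp add: is_subring_def)

lemma subring_diff: "x \<in> S \<Longrightarrow> y \<in> S \<Longrightarrow> x - y \<in> S"
  using S by (simp add: is_subring_def)

lemma subring_mult: "x \<in> S \<Longrightarrow> y \<in> S \<Longrightarrow> x * y \<in> S"
  using S by (simp add: is_subring_def)

lemma subring_zero: "0 \<in> S"
  using subring_diff[OF subring_one subring_one] by simp

lemma subring_uminus: "x \<in> S \<Longrightarrow> - x \<in> S"
  using subring_diff[OF subring_zero] by fastforce

lemma subring_add: "x \<in> S \<Longrightarrow> y \<in> S \<Longrightarrow> x + y \<in> S"
  using subring_diff[of x "- y"] subring_uminus by simp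

lemma subring_power: "x \<in> S \<Longrightarrow> x ^ n \<in> S"
  by (induction n) (auto intro: subring_one subring_mult)

lemma subring_sum: "(\<And>i. i \<in> I \<Longrightarrow> f i \<in> S) \<Longrightarrow> sum f I \<in> S"
  by (induction I rule: infinite_finite_induct) (auto intro: subring_zero subring_add)

lemma subring_prod: "(\<And>i. i \<in> I \<Longrightarrow> f i \<in> S) \<Longrightarrow> prod f I \<in> S"
  by (induction I rule: infinite_finite_induct) (auto intro: subring_one subring_mult)

lemma subring_poly: "(\<And>i. coeff p i \<in> S) \<Longrightarrow> x \<in> S \<Longrightarrow> poly p x \<in> S"
  unfolding poly_altdef by (intro subring_sum subring_mult subring_power)

lemmas subring_intros = subring_one subring_zero subring_diff subring_mult subring_uminus
  subring_add subring_power subring_sum subring_prod subring_poly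

text \<open>Convolution of coefficients stays in \<open>S\<close>. This makes \<open>adjoin\<close>
  a ring and keeps the coefficients of a characteristic polynomial in the base ring.\<close>

lemma is_subring_polys_over: "is_subring {p. \<forall>i. coeff p i \<in> S}"
  by (rule is_subringI) (auto simp: coeff_mult one_pCons coeff_pCons split: nat.splits
      intro!: subring_intros)

end

text \<open>As an intersection, the generated ring comes with an induction principle: a property
  passes to all elements once it holds on \<open>G\<close> and cuts out a subring.\<close>

definition ring_gen :: "'a::comm_ring_1 set \<Rightarrow> 'a set" where
  "ring_gen G = \<Inter>{S. is_subring S \<and> G \<subseteq> S}"

lemma is_subring_ring_gen: "is_subring (ring_gen G)"
  by (rule is_subringI) (auto simp: ring_gen_def intro: subring_intros)

lemma ring_gen_superset: "x \<in> G \<Longrightarrow> x \<in> ring_gen G"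
  by (auto simp: ring_gen_def)

lemma ring_gen_minimal: "is_subring S \<Longrightarrow> G \<subseteq> S \<Longrightarrow> ring_gen G \<subseteq> S"
  by (auto simp: ring_gen_def)

definition integral_over :: "'a::comm_ring_1 set \<Rightarrow> 'a \<Rightarrow> bool" where
  "integral_over A x \<longleftrightarrow> (\<exists>p. lead_coeff p = 1 \<and> (\<forall>i. coeff p i \<in> A) \<and> poly p x = 0)"

text \<open>The determinant trick: \<open>w\<close> is an eigenvalue of the matrix of multiplication by \<open>w\<close>
  with respect to the generators \<open>v\<^sub>i\<close>.\<close>

lemma integral_over_if_stable_module:
  fixes w :: "'a::field" and n :: nat
  assumes A: "is_subring A"
    and M: "\<And>i j. i < n \<Longrightarrow> j < n \<Longrightarrow> a i j \<in> A"
    and eq: "\<And>i. i < n \<Longrightarrow> w * v i = (\<Sum>j<n. a i j * v j)"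
    and nz: "i0 < n" "v i0 \<noteq> 0"
  shows "integral_over A w"
proof -
  define B where "B = mat n n (\<lambda>(i, j). a i j)"
  define u where "u = vec n v"
  have B: "B \<in> carrier_mat n n" by (simp add: B_def)
  have "B *\<^sub>v u = w \<cdot>\<^sub>v u"
    by (rule eq_vecI) (auto simp: B_def u_def scalar_prod_def eq lessThan_atLeast0)
  moreover have "u \<noteq> 0\<^sub>v n"
    using nz by (metis index_vec index_zero_vec(1) u_def)
  ultimately have "eigenvector B u w"
    using B by (auto simp: eigenvector_def u_def)
  then have root: "poly (char_poly B) w = 0"
    using eigenvalue_root_char_poly[OF B] by (auto simp: eigenvalue_def)
  have "char_poly B \<in> {p. \<forall>i. coeff p i \<in> A}"
    unfolding char_poly_def det_def'[OF char_poly_matrix_closed[OF B]]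
  proof (intro subring_sum[OF is_subring_polys_over[OF A]]
      subring_mult[OF is_subring_polys_over[OF A]] subring_prod[OF is_subring_polys_over[OF A]])
    fix p assume p: "p \<in> {p. p permutes {0..<n}}"
    show "of_int (sign p) \<in> {p. \<forall>i. coeff p i \<in> A}"
      using A by (auto simp: sign_def intro: subring_one subring_uminus subring_zero)
    fix i assume "i \<in> {0..<n}"
    then have "p i < n" "i < n" using p by (auto dest: permutes_in_image[of p "{0..<n}" i])
    then show "char_poly_matrix B $$ (i, p i) \<in> {p. \<forall>i. coeff p i \<in> A}"
      using A M by (auto simp: B_def char_poly_matrix_def coeff_pCons split: nat.splits
          intro!: subring_one subring_zero subring_uminus)
  qed
  with root degree_monic_char_poly[OF B] show ?thesis
    by (auto simp: integral_over_def)
qed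

section \<open>Finitely generated modules, and sums and products of integral elements\<close>

definition lin_span :: "'a::comm_ring_1 set \<Rightarrow> 'a list \<Rightarrow> 'a set" where
  "lin_span A vs = {\<Sum>j<length vs. c j * vs ! j |c. \<forall>j. c j \<in> A}"

text \<open>Since \<open>S\<close> is a ring, each product \<open>w * vs ! i\<close> lies in
  \<open>S\<close> and hence in the span; its coordinates form the matrix for the determinant
  trick.\<close>

lemma integral_over_if_finite:
  fixes w :: "'a::field"
  assumes A: "is_subring A" and S: "is_subring S" and vs: "set vs \<subseteq> S" and span: "S \<subseteq> lin_span A vs"
    and w: "w \<in> S"
  shows "integral_over A w"
proof -
  have "\<exists>c. (\<forall>j. c j \<in> A) \<and> w * vs ! i = (\<Sum>j<length vs. c j * vs ! j)" if "i < length vs" for i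
  proof -
    have "w * vs ! i \<in> lin_span A vs"
      using that vs span w by (auto intro!: subring_mult[OF S] subsetD[OF span])
    then show ?thesis by (auto simp: lin_span_def)
  qed
  then obtain a where a: "\<And>i j. i < length vs \<Longrightarrow> a i j \<in> A"
    "\<And>i. i < length vs \<Longrightarrow> w * vs ! i = (\<Sum>j<length vs. a i j * vs ! j)"
    by metis
  \<comment> \<open>A combination of the generators equals 1, so one of them is nonzero.\<close>
  have "1 \<in> lin_span A vs" using subring_one[OF S] span by auto
  then obtain c where "1 = (\<Sum>j<length vs. c j * vs ! j)" by (auto simp: lin_span_def)
  then obtain j where "j < length vs" "vs ! j \<noteq> 0"
    by (metis (no_types, lifting) lessThan_iff mult_zero_right sum.neutral zero_neq_one)
  with a show ?thesis by (intro integral_over_if_stable_module[OF A]) auto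
qed

lemma lin_span_mem: "v \<in> set vs \<Longrightarrow> 1 \<in> A \<Longrightarrow> 0 \<in> A \<Longrightarrow> v \<in> lin_span A vs"
proof -
  assume "v \<in> set vs" "1 \<in> A" "0 \<in> A"
  then obtain i where "i < length vs" "v = vs ! i" by (auto simp: in_set_conv_nth)
  then have "v = (\<Sum>j<length vs. (if j = i then 1 else 0) * vs ! j)"
    by (simp add: if_distrib[of "\<lambda>c. c * _"] cong: if_cong)
  then show ?thesis using \<open>1 \<in> A\<close> \<open>0 \<in> A\<close>
    unfolding lin_span_def by (intro CollectI exI[of _ "\<lambda>j. if j = i then 1 else 0"]) auto
qed

lemma lin_span_add:
  assumes "is_subring A" "x \<in> lin_span A vs" "y \<in> lin_span A vs" shows "x + y \<in> lin_span A vs"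
proof -
  from assms obtain c d where "\<forall>j. c j \<in> A" "\<forall>j. d j \<in> A"
    "x = (\<Sum>j<length vs. c j * vs ! j)" "y = (\<Sum>j<length vs. d j * vs ! j)"
    by (auto simp: lin_span_def)
  then show ?thesis using assms(1) unfolding lin_span_def
    by (intro CollectI exI[of _ "\<lambda>j. c j + d j"]) (auto simp: sum.distrib distrib_right intro: subring_add)
qed

lemma lin_span_scale:
  assumes "is_subring A" "a \<in> A" "x \<in> lin_span A vs" shows "a * x \<in> lin_span A vs"
proof -
  from assms obtain c where "\<forall>j. c j \<in> A" "x = (\<Sum>j<length vs. c j * vs ! j)"
    by (auto simp: lin_span_def)
  then show ?thesis using assms(1,2) unfolding lin_span_def
    by (intro CollectI exI[of _ "\<lambda>j. a * c j"]) (auto simp: sum_distrib_left mult.assoc intro: subring_mult)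
qed

lemma lin_span_sum:
  assumes "is_subring A" "\<And>i. i \<in> I \<Longrightarrow> f i \<in> lin_span A vs" shows "sum f I \<in> lin_span A vs"
proof -
  have "0 \<in> lin_span A vs"
    using subring_zero[OF assms(1)] unfolding lin_span_def by (intro CollectI exI[of _ "\<lambda>_. 0"]) auto
  then show ?thesis using assms(2)
    by (induction I rule: infinite_finite_induct) (auto intro: lin_span_add[OF assms(1)])
qed

definition adjoin :: "'a::comm_ring_1 set \<Rightarrow> 'a \<Rightarrow> 'a set" where
  "adjoin S x = {poly p x |p. \<forall>i. coeff p i \<in> S}"

text \<open>The new generators are the products \<open>v * x ^ i\<close> with \<open>i\<close> below
  the degree of the monic equation of \<open>x\<close>, which rewrites all higher powers.\<close>

lemma adjoin_finite:
  fixes x :: "'a::field"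
  assumes A: "is_subring A" and S: "is_subring S" "A \<subseteq> S" and vs: "set vs \<subseteq> S"
    and span: "S \<subseteq> lin_span A vs" and x: "integral_over A x"
  obtains ws where "is_subring (adjoin S x)" "S \<subseteq> adjoin S x" "x \<in> adjoin S x"
    "set ws \<subseteq> adjoin S x" "adjoin S x \<subseteq> lin_span A ws"
proof -
  obtain p where p: "lead_coeff p = 1" "\<forall>i. coeff p i \<in> A" "poly p x = 0"
    using x by (auto simp: integral_over_def)
  define n where "n = degree p"
  define ws where "ws = concat (map (\<lambda>i. map (\<lambda>v. v * x ^ i) vs) [0..<n])"
  have mem: "poly q x \<in> adjoin S x" if "\<forall>i. coeff q i \<in> S" for q
    using that by (auto simp: adjoin_def)
  note PS = is_subring_polys_over[OF S(1)]
  have R: "is_subring (adjoin S x)"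
  proof (rule is_subringI)
    show "1 \<in> adjoin S x" using mem[of 1] subring_one[OF PS] by simp
    fix a b assume "a \<in> adjoin S x" "b \<in> adjoin S x"
    then obtain f g where fg: "a = poly f x" "b = poly g x" "f \<in> {p. \<forall>i. coeff p i \<in> S}" "g \<in> {p. \<forall>i. coeff p i \<in> S}"
      by (auto simp: adjoin_def)
    show "a - b \<in> adjoin S x" using subring_diff[OF PS fg(3,4)] mem[of "f - g"] fg by simp
    show "a * b \<in> adjoin S x" using subring_mult[OF PS fg(3,4)] mem[of "f * g"] fg by simp
  qed
  have SR: "S \<subseteq> adjoin S x"
  proof
    fix s assume "s \<in> S"
    then show "s \<in> adjoin S x"
      using mem[of "[:s:]"] subring_zero[OF S(1)] by (auto simp: coeff_pCons split: nat.splits)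
  qed
  have xR: "x \<in> adjoin S x"
    using mem[of "[:0,1:]"] subring_zero[OF S(1)] subring_one[OF S(1)]
    by (auto simp: coeff_pCons split: nat.splits)
  have wsR: "set ws \<subseteq> adjoin S x"
    using vs SR xR by (auto simp: ws_def intro!: subring_mult[OF R] subring_power[OF R])
  have low: "s * x ^ i \<in> lin_span A ws" if i: "i < n" and s: "s \<in> S" for i s
  proof -
    obtain c where c: "\<forall>j. c j \<in> A" "s = (\<Sum>j<length vs. c j * vs ! j)"
      using s span by (auto simp: lin_span_def)
    have "s * x ^ i = (\<Sum>j<length vs. c j * (vs ! j * x ^ i))"
      unfolding c(2) by (simp add: sum_distrib_right mult.assoc)
    also have "\<dots> \<in> lin_span A ws"
    proof (rule lin_span_sum[OF A], rule lin_span_scale[OF A])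
      fix j assume "j \<in> {..<length vs}"
      then have "vs ! j * x ^ i \<in> set ws" using i by (auto simp: ws_def intro!: bexI[of _ i])
      then show "vs ! j * x ^ i \<in> lin_span A ws"
        by (rule lin_span_mem[OF _ subring_one[OF A] subring_zero[OF A]])
    qed (use c in auto)
    finally show ?thesis .
  qed
  \<comment> \<open>Strong induction on the exponent. Replacing \<open>x ^ n\<close> multiplies
    \<open>s\<close> by coefficients in \<open>A\<close>, so \<open>s\<close> must range over
    \<open>S\<close>.\<close>
  have all: "s * x ^ i \<in> lin_span A ws" if "s \<in> S" for i s
    using that
  proof (induction i arbitrary: s rule: less_induct)
    case (less i)
    show ?case
    proof (cases "i < n")
      case True then show ?thesis using low less.prems by blast
    next
      case False
      have "0 = (\<Sum>j\<le>n. coeff p j * x ^ j)" using p(3) by (simp add: poly_altdef n_def)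
      also have "\<dots> = (\<Sum>j<n. coeff p j * x ^ j) + x ^ n"
        using p(1) by (simp add: lessThan_Suc_atMost[symmetric] n_def)
      finally have "x ^ n = - (\<Sum>j<n. coeff p j * x ^ j)"
        using minus_unique[of "\<Sum>j<n. coeff p j * x ^ j" "x ^ n"] by simp
      moreover have "x ^ i = x ^ (i - n) * x ^ n" using False by (simp flip: power_add)
      ultimately have "s * x ^ i = - (\<Sum>j<n. s * coeff p j * (x ^ (i - n) * x ^ j))"
        by (simp add: sum_distrib_left mult_ac)
      also have "\<dots> = (\<Sum>j<n. (- (s * coeff p j)) * x ^ (i - n + j))"
        by (simp add: sum_negf power_add)
      also have "\<dots> \<in> lin_span A ws"
        using less.prems False p(2) S(2)
        by (intro lin_span_sum A less.IH) (auto intro!: subring_uminus[OF S(1)] subring_mult[OF S(1)])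
      finally show ?thesis .
    qed
  qed
  have "adjoin S x \<subseteq> lin_span A ws"
    by (auto simp: adjoin_def poly_altdef intro!: lin_span_sum A all)
  with R SR xR wsR show thesis by (rule that)
qed

text \<open>Adjoining \<open>x\<close> and then \<open>y\<close> gives a ring inside a finite span
  over \<open>A\<close> that contains both \<open>x - y\<close> and \<open>x * y\<close>.\<close>

lemma integral_over_diff_mult:
  fixes x y :: "'a::field"
  assumes A: "is_subring A" and x: "integral_over A x" and y: "integral_over A y"
  shows "integral_over A (x - y)" "integral_over A (x * y)"
proof -
  have "A \<subseteq> lin_span A [1]"
  proof
    fix a assume "a \<in> A"
    then show "a \<in> lin_span A [1]" by (auto simp: lin_span_def intro!: exI[of _ "\<lambda>_. a"])
  qed
  then obtain us where us: "is_subring (adjoin A x)" "A \<subseteq> adjoin A x" "x \<in> adjoin A x"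
    "set us \<subseteq> adjoin A x" "adjoin A x \<subseteq> lin_span A us"
    using adjoin_finite[OF A A order_refl _ _ x, of "[1]"] subring_one[OF A] by auto
  obtain ws where ws: "is_subring (adjoin (adjoin A x) y)" "adjoin A x \<subseteq> adjoin (adjoin A x) y"
    "y \<in> adjoin (adjoin A x) y" "set ws \<subseteq> adjoin (adjoin A x) y"
    "adjoin (adjoin A x) y \<subseteq> lin_span A ws"
    using adjoin_finite[OF A us(1,2,4,5) y] .
  show "integral_over A (x - y)" "integral_over A (x * y)"
    using us(3) ws by (auto intro!: integral_over_if_finite[OF A ws(1,4,5)] subring_diff[OF ws(1)] subring_mult[OF ws(1)])
qed

lemma integral_over_self:
  assumes "is_subring A" "a \<in> A"
  shows "integral_over A (a :: 'a::field)"
  unfolding integral_over_def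
  using assms by (intro exI[of _ "[:-a, 1:]"])
    (auto simp: coeff_pCons split: nat.splits intro: subring_intros)

lemma integral_over_ring_gen:
  fixes A :: "'a::field set"
  assumes A: "is_subring A" and X: "\<And>x. x \<in> X \<Longrightarrow> integral_over A x" and w: "w \<in> ring_gen X"
  shows "integral_over A w"
proof -
  have "is_subring {x. integral_over A x}"
    by (rule is_subringI) (auto intro: integral_over_self[OF A] subring_one[OF A] integral_over_diff_mult[OF A])
  then show ?thesis using ring_gen_minimal[of "{x. integral_over A x}" X] X w by auto
qed

text \<open>Multiplying the monic equation of \<open>w\<close>, of degree \<open>n\<close>, by
  \<open>c ^ n\<close> turns its leading term into 1 and leaves a factor \<open>c\<close> in every
  other term.\<close>

lemma unit_if_inverse_integral:
  fixes w :: "'a::field"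
  assumes A: "is_subring A" and w: "integral_over A w" and c: "c \<in> A" "c * w = 1"
  shows "\<exists>b\<in>A. c * b = 1"
proof -
  obtain p where p: "lead_coeff p = 1" "\<forall>i. coeff p i \<in> A" "poly p w = 0"
    using w by (auto simp: integral_over_def)
  define n where "n = degree p"
  have n: "n > 0"
  proof (rule ccontr)
    assume "\<not> n > 0"
    then obtain a where "p = [:a:]" unfolding n_def by (metis degree_eq_zeroE neq0_conv)
    then show False using p by simp
  qed
  have cw: "c ^ n * w ^ i = c * c ^ (n - 1 - i)" if "i < n" for i
  proof -
    from less_imp_Suc_add[OF that] obtain k where k: "n = i + Suc k" by auto
    have "c ^ n * w ^ i = (c * w) ^ i * c ^ Suc k"
      unfolding k power_add power_mult_distrib by (simp only: mult_ac)
    then show ?thesis using c k by simp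
  qed
  have "0 = c ^ n * (\<Sum>j\<le>n. coeff p j * w ^ j)" using p(3) by (simp add: poly_altdef n_def)
  also have "\<dots> = c ^ n * (\<Sum>j<n. coeff p j * w ^ j) + c ^ n * w ^ n"
    using p(1) by (simp add: lessThan_Suc_atMost[symmetric] n_def distrib_left)
  also have "c ^ n * w ^ n = 1" using c by (simp flip: power_mult_distrib)
  also have "c ^ n * (\<Sum>j<n. coeff p j * w ^ j) = (\<Sum>j<n. coeff p j * (c ^ n * w ^ j))"
    by (simp add: sum_distrib_left mult_ac)
  also have "\<dots> = (\<Sum>j<n. coeff p j * (c * c ^ (n - 1 - j)))"
    by (intro sum.cong) (auto simp: cw)
  also have "\<dots> = c * (\<Sum>j<n. coeff p j * c ^ (n - 1 - j))"
    by (simp add: sum_distrib_left mult_ac)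
  finally have "c * (- (\<Sum>j<n. coeff p j * c ^ (n - 1 - j))) = 1"
    by (simp add: add_eq_0_iff)
  moreover have "- (\<Sum>j<n. coeff p j * c ^ (n - 1 - j)) \<in> A"
    using p(2) c by (intro subring_uminus[OF A] subring_sum[OF A] subring_mult[OF A] subring_power[OF A]) auto
  ultimately show ?thesis by blast
qed

text \<open>A relation with nonzero constant term reads \<open>a * poly q a = - c\<close>, so
  \<open>poly q a\<close> is the cofactor. This later brings denominators of fractions down into
  \<open>A\<close>.\<close>

lemma divides_base_element:
  fixes a :: "'a::field"
  assumes A: "is_subring A" and R: "is_subring R" "A \<subseteq> R" and a: "a \<in> R" "a \<noteq> 0" "integral_over A a"
  shows "\<exists>b\<in>R. a * b \<in> A \<and> a * b \<noteq> 0"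
proof -
  \<comment> \<open>The induction on \<open>p\<close> removes a vanishing constant term by
    cancelling \<open>a\<close>.\<close>
  have "\<exists>b\<in>R. a * b \<in> A \<and> a * b \<noteq> 0" if "p \<noteq> 0" "\<forall>i. coeff p i \<in> A" "poly p a = 0" for p
    using that
  proof (induction p)
    case (pCons c q)
    have q: "\<forall>i. coeff q i \<in> A"
    proof
      fix i show "coeff q i \<in> A" using pCons.prems(2)[rule_format, of "Suc i"] by simp
    qed
    have c: "c \<in> A" using pCons.prems(2)[rule_format, of 0] by simp
    show ?case
    proof (cases "c = 0")
      case True
      then have "q \<noteq> 0" "poly q a = 0" using pCons.prems a by auto
      then show ?thesis using pCons.IH q by blast
    next
      case False
      have eq: "a * poly q a = - c" using pCons.prems(3) by (simp add: add_eq_0_iff)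
      have "poly q a \<in> R" by (rule subring_poly[OF R(1)]) (use q R a in auto)
      moreover have "a * poly q a \<in> A" unfolding eq by (rule subring_uminus[OF A c])
      moreover have "a * poly q a \<noteq> 0" unfolding eq using False by simp
      ultimately show ?thesis by blast
    qed
  qed simp
  moreover obtain p where "lead_coeff p = 1" "\<forall>i. coeff p i \<in> A" "poly p a = 0"
    using a(3) by (auto simp: integral_over_def)
  moreover from this(1) have "p \<noteq> 0" by auto
  ultimately show ?thesis by blast
qed

subsection \<open>Irreducible polynomials over finite fields\<close>

lemma CHAR_prime_finite: "prime CHAR('a::{field,finite})"
proof -
  have "CHAR('a) > 0" by (rule finite_imp_CHAR_pos) simp
  then show ?thesis by (rule prime_CHAR_semidom)
qed

lemma frobenius_power_diff:
  fixes x y :: "'a::comm_ring_1"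
  assumes "prime CHAR('a)" "s = CHAR('a) ^ n"
  shows "(x - y) ^ s = x ^ s - y ^ s"
  using freshmans_dream'[OF assms, of "x - y" y] by simp

lemma monic_irreducible_dvd_imp_eq:
  fixes g h :: "'a::field poly"
  assumes "lead_coeff g = 1" "lead_coeff h = 1" "irreducible g" "irreducible h" "g dvd h"
  shows "g = h"
proof -
  obtain c where c: "h = g * c" using assms(5) by (rule dvdE)
  have "\<not> g dvd 1" by (rule irreducible_not_unit[OF assms(3)])
  then have "c dvd 1" using irreducibleD[OF assms(4) c] by blast
  then obtain a where "c = [:a:]" by (metis degree_eq_zeroE is_unit_poly_iff degree_pCons_0)
  moreover have "lead_coeff c = 1" using assms(1,2) c by (simp add: lead_coeff_mult)
  ultimately show ?thesis using c by (auto simp: one_pCons)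
qed

lemma monic_irreducible_not_dvd_prod_list:
  fixes g :: "'a::field poly"
  assumes "lead_coeff g = 1" "irreducible g" "\<forall>h\<in>set gs. lead_coeff h = 1 \<and> irreducible h" "g \<notin> set gs"
  shows "\<not> g dvd prod_list gs"
  using assms(3,4)
proof (induction gs)
  case Nil
  then show ?case using assms(2) irreducible_not_unit[of g] by simp
next
  case (Cons h gs)
  have "prime_elem g" by (rule field_poly_irreducible_imp_prime[OF assms(2)])
  moreover have "\<not> g dvd h" using monic_irreducible_dvd_imp_eq[of g h] assms(1,2) Cons.prems by auto
  ultimately show ?case using Cons by (auto simp: prime_elem_dvd_mult_iff)
qed

text \<open>Distinct monic irreducibles are pairwise coprime: once \<open>prod_list gs\<close> is
  divided out of \<open>f\<close>, the prime \<open>g\<close> must divide the remaining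
  factor.\<close>

lemma prod_list_irreducible_dvd:
  fixes gs :: "'a::field poly list"
  assumes "distinct gs" "\<forall>g\<in>set gs. lead_coeff g = 1 \<and> irreducible g" "\<forall>g\<in>set gs. g dvd f"
  shows "prod_list gs dvd f"
  using assms
proof (induction gs)
  case (Cons g gs)
  then obtain k where k: "f = prod_list gs * k" by (auto elim: dvdE)
  have "prime_elem g" using Cons.prems by (intro field_poly_irreducible_imp_prime) auto
  moreover have "\<not> g dvd prod_list gs" using Cons.prems by (intro monic_irreducible_not_dvd_prod_list) auto
  moreover have "g dvd prod_list gs * k" using Cons.prems k by auto
  ultimately have "g dvd k" by (simp add: prime_elem_dvd_mult_iff)
  then show ?case using k by (simp add: mult.commute mult_dvd_mono)
qed simp

section \<open>Frobenius powers modulo a polynomial\<close>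

lemma finite_polys_degree_less: "finite {f :: 'a::{zero,finite} poly. f = 0 \<or> degree f < n}"
proof (rule finite_subset)
  show "{f :: 'a poly. f = 0 \<or> degree f < n} \<subseteq> Poly ` {xs. set xs \<subseteq> UNIV \<and> length xs \<le> n}"
  proof
    fix f :: "'a poly" assume "f \<in> {f. f = 0 \<or> degree f < n}"
    then have "length (coeffs f) \<le> n" by (cases "f = 0") (auto simp: length_coeffs)
    then show "f \<in> Poly ` {xs. set xs \<subseteq> UNIV \<and> length xs \<le> n}"
      by (intro image_eqI[of _ _ "coeffs f"]) auto
  qed
  show "finite (Poly ` {xs :: 'a list. set xs \<subseteq> UNIV \<and> length xs \<le> n})"
    by (intro finite_imageI finite_lists_length_le) simp
qed

lemma finite_range_poly_mod:
  fixes g :: "'a::{field,finite} poly"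
  assumes "g \<noteq> 0"
  shows "finite (range (\<lambda>f. f mod g))"
proof (rule finite_subset[OF _ finite_polys_degree_less[of "degree g"]])
  show "range (\<lambda>f. f mod g) \<subseteq> {f. f = 0 \<or> degree f < degree g}"
    using degree_mod_less[OF assms] by auto
qed

text \<open>Pigeonhole on Frobenius iterates: two exponents \<open>a < b\<close> act alike on all
  constants and on the residue of \<open>[:0, 1:]\<close>. Additivity of Frobenius lets their
  difference serve as \<open>n\<close>.\<close>

lemma frobenius_exponent:
  fixes gs :: "'a::{field,finite} poly list"
  assumes "distinct gs" "\<forall>g\<in>set gs. lead_coeff g = 1 \<and> irreducible g"
  obtains n where "n > 0" "\<And>c::'a. c ^ (CHAR('a) ^ n) = c"
    "prod_list gs dvd [:0, 1:] ^ (CHAR('a) ^ n) - [:0, 1:]"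
proof -
  define p where "p = CHAR('a)"
  define g where "g = prod_list gs"
  have p: "prime p" unfolding p_def by (rule CHAR_prime_finite)
  have g0: "g \<noteq> 0" using assms(2) by (auto simp: g_def prod_list_zero_iff)
  define F where "F n = ((\<lambda>c::'a. c ^ (p ^ n)), ([:0, 1:] ^ (p ^ n)) mod g)" for n
  have "finite (range F)"
  proof (rule finite_subset)
    show "range F \<subseteq> UNIV \<times> range (\<lambda>f. f mod g)" by (auto simp: F_def)
    show "finite (UNIV \<times> range (\<lambda>f. f mod g) :: (('a \<Rightarrow> 'a) \<times> 'a poly) set)"
      using finite_range_poly_mod[OF g0] by (intro finite_cartesian_product) auto
  qed
  then have "\<not> inj F" using finite_imageD infinite_UNIV_nat by blast
  then obtain a b where ab: "a < b" "F a = F b"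
    by (metis injI linorder_neqE_nat)
  define n where "n = b - a"
  have pb: "p ^ b = p ^ n * p ^ a" using ab(1) by (simp add: n_def flip: power_add)
  \<comment> \<open>Stated for any ring of characteristic \<open>p\<close>, since it is applied both
    to constants and to the polynomial \<open>[:0, 1:]\<close>.\<close>
  have frob: "(x ^ (p ^ n) - x) ^ (p ^ a) = x ^ (p ^ b) - x ^ (p ^ a)"
    if "CHAR('b) = p" for x :: "'b::comm_ring_1"
    using frobenius_power_diff[of "p ^ a" a "x ^ (p ^ n)" x] that p by (simp add: pb power_mult)
  have "c ^ (p ^ n) = c" for c :: 'a
  proof -
    have "(c ^ (p ^ n) - c) ^ (p ^ a) = 0"
      using frob[of c] ab(2) by (auto simp: F_def p_def fun_eq_iff)
    then show ?thesis by (metis eq_iff_diff_eq_0 power_not_zero)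
  qed
  note power_fix = this
  have g_dvd: "g dvd ([:0, 1:] ^ (p ^ n) - [:0, 1:]) ^ (p ^ a)"
    using frob[of "[:0, 1::'a:]"] ab(2) mod_eq_dvd_iff[of "[:0, 1::'a:] ^ (p ^ b)" g "[:0, 1::'a:] ^ (p ^ a)"]
    by (simp add: F_def p_def)
  \<comment> \<open>An irreducible factor that divides a power divides the base, which removes the
    exponent \<open>p ^ a\<close>.\<close>
  have "h dvd [:0, 1:] ^ (p ^ n) - [:0, 1:]" if "h \<in> set gs" for h
  proof -
    have "h dvd g" using split_list[OF that] by (auto simp: g_def)
    then have "h dvd ([:0, 1:] ^ (p ^ n) - [:0, 1:]) ^ (p ^ a)" using g_dvd by (rule dvd_trans)
    then show ?thesis
      using that assms(2) field_poly_irreducible_imp_prime[of h] prime_elem_dvd_power by blast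
  qed
  then have "prod_list gs dvd [:0, 1:] ^ (p ^ n) - [:0, 1:]"
    using assms by (intro prod_list_irreducible_dvd) auto
  with power_fix show thesis using that[of n] ab(1) by (auto simp: n_def p_def)
qed

text \<open>This polynomial arises by eliminating t from \<open>Mt M m\<close> and its derivative,
  so it controls separability. If it vanished, its value at 0 would make \<open>m\<close> zero in
  the field, hence \<open>pderiv M = 0\<close>, and a factor \<open>g\<close> would divide its own
  derivative.\<close>

lemma wronskian_nonzero:
  fixes M :: "'a::{field,finite} poly"
  assumes deg: "degree M = 2 * m" and M0: "poly M 0 = 1"
    and M: "M = [:-1, 1:] ^ 2 * prod_list gs" and dist: "distinct gs"
    and irr: "\<forall>g\<in>set gs. lead_coeff g = 1 \<and> irreducible g \<and> g \<noteq> [:-1, 1:]"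
  shows "[:0, 1:] * pderiv M - Polynomial.smult (of_nat m) M \<noteq> 0"
proof
  assume eq: "[:0, 1:] * pderiv M - Polynomial.smult (of_nat m) M = 0"
  have m: "of_nat m = (0::'a)"
    using arg_cong[OF eq, of "\<lambda>f. poly f 0"] M0 by simp
  have der: "pderiv M = 0" using eq m by simp
  \<comment> \<open>With no factors \<open>M\<close> would be \<open>[:-1, 1:] ^ 2\<close>, so
    \<open>m = 1\<close>, which is not zero in the field.\<close>
  have "gs \<noteq> []"
  proof
    assume "gs = []"
    then have "degree M = 2" using M by (simp add: degree_power_eq)
    then have "m = 1" using deg by simp
    then show False using m by simp
  qed
  then obtain g gs' where gs: "gs = g # gs'" by (cases gs) auto
  define h where "h = [:-1, 1:] ^ 2 * prod_list gs'"
  have g: "irreducible g" "lead_coeff g = 1" "g \<noteq> [:-1, 1:]" using irr gs by auto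
  have prime: "prime_elem g" by (rule field_poly_irreducible_imp_prime[OF g(1)])
  have "\<not> g dvd [:-1, 1:]"
    using monic_irreducible_dvd_imp_eq[of g "[:-1, 1:]"] g irreducible_linear_field_poly[of 1 "-1::'a"]
    by auto
  moreover have "\<not> g dvd prod_list gs'"
    using irr dist gs by (intro monic_irreducible_not_dvd_prod_list) auto
  ultimately have gh: "\<not> g dvd h"
    using prime by (auto simp: h_def prime_elem_dvd_mult_iff dest: prime_elem_dvd_power)
  have "M = g * h" using M gs by (simp add: h_def mult_ac)
  then have "g * pderiv h + h * pderiv g = 0" using der by (simp add: pderiv_mult)
  then have "g dvd h * pderiv g" by (metis add_eq_0_iff dvd_minus_iff dvd_triv_left)
  then have g': "g dvd pderiv g" using gh prime by (simp add: prime_elem_dvd_mult_iff)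
  \<comment> \<open>The factor \<open>g\<close> divides some x^s - x, whose derivative is -1, so it
    cannot also divide \<open>pderiv g\<close>.\<close>
  obtain n where n: "n > 0" "prod_list gs dvd [:0, 1:] ^ (CHAR('a) ^ n) - [:0, 1:]"
    using frobenius_exponent[OF dist] irr by metis
  define s where "s = CHAR('a) ^ n"
  have s0: "of_nat s = (0::'a)" using n(1) by (simp add: s_def)
  obtain k where k: "[:0, 1:] ^ s - [:0, 1:] = g * k"
    using n(2) gs by (metis dvdE dvd_mult_left prod_list.Cons s_def)
  have "s > 0" using CHAR_prime_finite[where ?'a='a] by (simp add: s_def prime_gt_0_nat)
  then have "pderiv ([:0, 1:] ^ s - [:0, 1::'a:]) = - 1"
    using s0 by (cases s) (simp_all only: pderiv_diff pderiv_power_Suc, simp add: pderiv_pCons one_pCons)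
  then have "g dvd - 1" unfolding k pderiv_mult using g' by (metis dvd_add dvd_mult dvd_triv_left)
  then show False using irreducible_not_unit[OF g(1)] by simp
qed

subsection \<open>Evaluation over a field of constants\<close>

lemma is_field_hom_simps:
  assumes "is_field_hom f"
  shows "f 0 = 0" "f 1 = 1" "f (x + y) = f x + f y" "f (x * y) = f x * f y" "f (- x) = - f x"
    "f (x - y) = f x - f y" "f (x ^ n) = f x ^ n" "f (inverse x) = inverse (f x)" "f x = 0 \<longleftrightarrow> x = 0"
proof -
  note h = assms[unfolded is_field_hom_def]
  show 0: "f 0 = 0" and 1: "f 1 = 1" and add: "\<And>x y. f (x + y) = f x + f y"
    and mult: "\<And>x y. f (x * y) = f x * f y" using h by auto
  show neg: "\<And>x. f (- x) = - f x"
    using 0 add by (metis add.inverse_unique add.right_inverse)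
  show "f (x - y) = f x - f y" using add[of x "- y"] neg[of y] by simp
  show "f (x ^ n) = f x ^ n" by (induction n) (simp_all add: 1 mult)
  have inv: "f x * f (inverse x) = 1" if "x \<noteq> 0" for x using mult[of x "inverse x"] 1 that by simp
  show z: "f x = 0 \<longleftrightarrow> x = 0" using inv[of x] 0 by (metis mult_zero_left zero_neq_one)
  show "f (inverse x) = inverse (f x)"
    using inv[of x] 0 by (cases "x = 0") (auto intro: inverse_unique[symmetric])
qed

locale constants =
  fixes \<iota> :: "'a::field \<Rightarrow> 'l::field"
  assumes hom: "is_field_hom \<iota>"
begin

lemmas \<iota>_simps = is_field_hom_simps[OF hom]

definition ev :: "'l \<Rightarrow> 'a poly \<Rightarrow> 'l" where
  "ev v f = poly (map_poly \<iota> f) v"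

lemma ev_0 [simp]: "ev v 0 = 0"
  by (simp add: ev_def)

lemma ev_pCons [simp]: "ev v (pCons c f) = \<iota> c + v * ev v f"
proof -
  have "map_poly \<iota> (pCons c f) = pCons (\<iota> c) (map_poly \<iota> f)"
    by (rule poly_eqI) (simp add: coeff_map_poly coeff_pCons \<iota>_simps split: nat.split)
  then show ?thesis by (simp add: ev_def)
qed

lemma ev_1 [simp]: "ev v 1 = 1"
  by (simp add: one_pCons \<iota>_simps)

lemma ev_add [simp]: "ev v (f + g) = ev v f + ev v g"
  by (induction f g rule: poly_induct2) (simp_all add: \<iota>_simps algebra_simps)

lemma ev_uminus [simp]: "ev v (- f) = - ev v f"
  by (induction f) (simp_all add: \<iota>_simps)

lemma ev_diff [simp]: "ev v (f - g) = ev v f - ev v g"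
  using ev_add[of v f "- g"] by simp

lemma ev_smult [simp]: "ev v (Polynomial.smult c f) = \<iota> c * ev v f"
  by (induction f) (simp_all add: \<iota>_simps algebra_simps)

lemma ev_mult [simp]: "ev v (f * g) = ev v f * ev v g"
  by (induction f) (simp_all add: \<iota>_simps algebra_simps)

lemma ev_power [simp]: "ev v (f ^ n) = ev v f ^ n"
  by (induction n) simp_all

lemma ev_monom [simp]: "ev v (monom c n) = \<iota> c * v ^ n"
  by (simp add: ev_def map_poly_monom \<iota>_simps poly_monom)

lemma ev_\<iota>: "ev (\<iota> c) f = \<iota> (poly f c)"
  by (induction f) (simp_all add: \<iota>_simps)

lemma \<iota>_of_nat [simp]: "\<iota> (of_nat n) = of_nat n"
  by (induction n) (simp_all add: \<iota>_simps)

lemma \<iota>_numeral [simp]: "\<iota> (numeral k) = numeral k"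
  using \<iota>_of_nat[of "numeral k"] by simp

lemma is_subring_range_ev: "is_subring (range (ev v))"
  by (rule is_subringI) (metis ev_1 rangeI, auto simp flip: ev_diff ev_mult)

lemma range_ev_self: "v \<in> range (ev v)"
  using rangeI[of "ev v" "[:0, 1:]"] by (simp add: \<iota>_simps)

lemma range_ev_\<iota>: "\<iota> c \<in> range (ev v)"
  using rangeI[of "ev v" "[:c:]"] by simp

lemma ev_in_subring:
  assumes "is_subring S" "range \<iota> \<subseteq> S" "v \<in> S"
  shows "ev v f \<in> S"
  unfolding ev_def by (rule subring_poly) (use assms in \<open>auto simp: coeff_map_poly \<iota>_simps\<close>)

text \<open>As usual \<open>a - b\<close> divides the difference; the point is that the cofactor
  stays in \<open>S\<close>. Needed to specialise \<open>u\<close> to 2 and to compare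
  \<open>Q\<close> at two pair sums.\<close>

lemma ev_diff_factor:
  assumes S: "is_subring S" "range \<iota> \<subseteq> S" "a \<in> S" "b \<in> S"
  shows "\<exists>h\<in>S. ev a f - ev b f = (a - b) * h"
proof (induction f)
  case 0
  then show ?case using subring_zero[OF S(1)] by auto
next
  case (pCons c f)
  then obtain h where h: "h \<in> S" "ev a f - ev b f = (a - b) * h" by auto
  have "ev a (pCons c f) - ev b (pCons c f) = a * (ev a f - ev b f) + (a - b) * ev b f"
    by (simp add: algebra_simps)
  also have "\<dots> = (a - b) * (a * h + ev b f)" unfolding h(2) by (simp add: algebra_simps)
  finally show ?case
    using h(1) S ev_in_subring[OF S(1,2,4), of f]
    by (intro bexI[of _ "a * h + ev b f"]) (auto intro: subring_intros)
qed

definition transcendental :: "'l \<Rightarrow> bool" where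
  "transcendental v \<longleftrightarrow> (\<forall>f. ev v f = 0 \<longrightarrow> f = 0)"

text \<open>\<open>D\<close> is the Dickson polynomial with parameter 1, obtained from the
  recurrence D(k+2) = v D(k+1) - D(k) with v = x + 1/x.\<close>

lemma dickson:
  "\<exists>D. \<forall>x. x \<noteq> 0 \<longrightarrow> x ^ n + inverse x ^ n = ev (x + inverse x) D"
proof (induction n rule: less_induct)
  case (less n)
  consider "n = 0" | "n = 1" | k where "n = Suc (Suc k)" by (metis One_nat_def not0_implies_Suc)
  then show ?case
  proof cases
    case 1 then show ?thesis by (intro exI[of _ "[:2:]"]) simp
  next
    case 2 then show ?thesis by (intro exI[of _ "[:0, 1:]"]) (simp add: \<iota>_simps)
  next
    case 3
    obtain D E where D: "\<And>x. x \<noteq> 0 \<Longrightarrow> x ^ k + inverse x ^ k = ev (x + inverse x) D"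
      and E: "\<And>x. x \<noteq> 0 \<Longrightarrow> x ^ Suc k + inverse x ^ Suc k = ev (x + inverse x) E"
      using less[of k] less[of "Suc k"] 3 by auto
    show ?thesis
    proof (intro exI[of _ "[:0, 1:] * E - D"] allI impI)
      fix x :: 'l assume x: "x \<noteq> 0"
      have "ev (x + inverse x) ([:0, 1:] * E - D) =
          (x + inverse x) * (x ^ Suc k + inverse x ^ Suc k) - (x ^ k + inverse x ^ k)"
        using D[OF x] E[OF x] by (simp add: \<iota>_simps)
      also have "\<dots> = x ^ n + inverse x ^ n" unfolding 3 using x by (simp add: field_simps)
      finally show "x ^ n + inverse x ^ n = ev (x + inverse x) ([:0, 1:] * E - D)" by simp
    qed
  qed
qed

text \<open>Induction on \<open>m\<close> peels off the two equal outer coefficients, which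
  contribute a multiple of x^m (x^m + x^-m), a Dickson polynomial up to the factor x^m.\<close>

lemma palindromic_in_sum_with_inverse:
  assumes "degree f \<le> 2 * m" "\<And>i. i \<le> 2 * m \<Longrightarrow> coeff f i = coeff f (2 * m - i)"
  shows "\<exists>P. \<forall>x. x \<noteq> 0 \<longrightarrow> ev x f = x ^ m * ev (x + inverse x) P"
  using assms
proof (induction m arbitrary: f)
  case 0
  then obtain c where "f = [:c:]" by (metis degree_eq_zeroE le_zero_eq mult_0_right)
  then show ?case by (intro exI[of _ "[:c:]"]) simp
next
  case (Suc m)
  obtain c f1 where f: "f = pCons c f1" by (cases f)
  \<comment> \<open>Dropping both outer terms and one factor x leaves a palindromic polynomial of
    degree at most \<open>2 * m\<close>.\<close>
  define g where "g = f1 - monom c (Suc (2 * m))"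
  have "coeff f (2 * Suc m) = c" using Suc.prems(2)[of 0] f by simp
  then have top: "coeff f1 (Suc (2 * m)) = c" using f by simp
  have cg: "coeff g i = (if i \<le> 2 * m then coeff f (Suc i) else 0)" for i
  proof -
    consider "i \<le> 2 * m" | "i = Suc (2 * m)" | "i > Suc (2 * m)" by linarith
    then show ?thesis
    proof cases
      case 3
      then have "coeff f (Suc i) = 0" using Suc.prems(1) by (intro coeff_eq_0) simp
      then show ?thesis using 3 f by (simp add: g_def)
    qed (use f top in \<open>auto simp: g_def\<close>)
  qed
  have "degree g \<le> 2 * m" by (rule degree_le) (simp add: cg)
  moreover have "coeff g i = coeff g (2 * m - i)" if "i \<le> 2 * m" for i
    using Suc.prems(2)[of "Suc i"] that by (simp add: cg Suc_diff_le)
  ultimately obtain P where P: "\<And>x. x \<noteq> 0 \<Longrightarrow> ev x g = x ^ m * ev (x + inverse x) P"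
    using Suc.IH by blast
  obtain D where D: "\<And>x. x \<noteq> 0 \<Longrightarrow> x ^ Suc m + inverse x ^ Suc m = ev (x + inverse x) D"
    using dickson[of "Suc m"] by blast
  show ?case
  proof (intro exI[of _ "P + Polynomial.smult c D"] allI impI)
    fix x :: 'l assume x: "x \<noteq> 0"
    have "f1 = g + monom c (Suc (2 * m))" by (simp add: g_def)
    then have "ev x f = \<iota> c + x * (ev x g + \<iota> c * x ^ Suc (2 * m))" using f by simp
    also have "\<dots> = x ^ Suc m * ev (x + inverse x) P + \<iota> c * (1 + x ^ (Suc m + Suc m))"
      using P[OF x] by (simp add: algebra_simps flip: mult_2 mult_2_right)
    also have "1 + x ^ (Suc m + Suc m) = x ^ Suc m * (x ^ Suc m + inverse x ^ Suc m)"
      using x by (simp only: power_add distrib_left flip: power_mult_distrib) simp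
    finally show "ev x f = x ^ Suc m * ev (x + inverse x) (P + Polynomial.smult c D)"
      by (simp only: D[OF x] ev_add ev_smult) (simp add: algebra_simps)
  qed
qed

end

section \<open>Transcendence over a finite field\<close>

lemma power_eq_if_finite:
  assumes "finite S" "is_subring S" "x \<in> S"
  shows "\<exists>i j. i < j \<and> x ^ i = x ^ j"
proof -
  have "range (\<lambda>n. x ^ n) \<subseteq> S" using subring_power[OF assms(2,3)] by auto
  then have "finite (range (\<lambda>n. x ^ n))" using assms(1) finite_subset by blast
  then have "\<not> inj (\<lambda>n::nat. x ^ n)" using finite_imageD infinite_UNIV_nat by blast
  then show ?thesis by (metis injI linorder_neqE_nat)
qed

locale finite_constants = constants \<iota> for \<iota> :: "'a::{field,finite} \<Rightarrow> 'l::field"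
begin

lemma finite_range_ev_if_algebraic:
  assumes "\<not> transcendental v"
  shows "finite (range (ev v))"
proof -
  obtain f where f: "f \<noteq> 0" "ev v f = 0" using assms by (auto simp: transcendental_def)
  have "ev v h = ev v (h mod f)" for h
  proof -
    have "ev v h = ev v (h div f * f + h mod f)" by simp
    also have "\<dots> = ev v (h mod f)" using f(2) by (simp only: ev_add ev_mult) simp
    finally show ?thesis .
  qed
  then have "range (ev v) \<subseteq> ev v ` range (\<lambda>h. h mod f)" by auto
  then show ?thesis using finite_range_poly_mod[OF f(1)] finite_subset by blast
qed

text \<open>If \<open>v\<close> were algebraic, the finite ring \<open>range (ev v)\<close> would
  contain all powers of \<open>T\<close>; two of them would agree, making \<open>T\<close>
  algebraic.\<close>

lemma transcendental_if_in_range_ev: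
  assumes "transcendental T" "T \<in> range (ev v)"
  shows "transcendental v"
proof (rule ccontr)
  assume "\<not> transcendental v"
  from power_eq_if_finite[OF finite_range_ev_if_algebraic[OF this] is_subring_range_ev assms(2)]
  obtain i j where ij: "i < j" "T ^ i = T ^ j" by blast
  then have "ev T (monom 1 i - monom 1 j) = 0" by (simp add: \<iota>_simps)
  then have "monom 1 i - monom 1 j = (0 :: 'a poly)" using assms(1) unfolding transcendental_def by blast
  then have "coeff (monom 1 i - monom 1 j) i = (0::'a)" by simp
  then show False using ij(1) by simp
qed

text \<open>An algebraic nonzero \<open>v\<close> is a root of unity, because its powers repeat.
  Then \<open>inverse v\<close> is a power of \<open>v\<close>, and the sum lies in
  \<open>range (ev v)\<close>.\<close>

lemma transcendental_if_sum_with_inverse: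
  assumes "transcendental (v + inverse v)" "v \<noteq> 0"
  shows "transcendental v"
proof (rule ccontr)
  assume nt: "\<not> transcendental v"
  note R = is_subring_range_ev[of v] and v = range_ev_self[of v]
  from power_eq_if_finite[OF finite_range_ev_if_algebraic[OF nt] R v]
  obtain i j where ij: "i < j" "v ^ i = v ^ j" by blast
  then obtain k where "j = i + Suc k" using less_imp_Suc_add by fastforce
  then have "v ^ k * v = 1" using ij(2) assms(2) by (simp add: power_add mult.commute)
  then have "inverse v = v ^ k" using assms(2) by (metis inverse_unique mult.commute)
  then have "v + inverse v \<in> range (ev v)"
    using R v by (auto intro: subring_add subring_power simp del: image_iff)
  then show False using nt transcendental_if_in_range_ev assms(1) by blast
qed

end

subsection \<open>The ramification argument and quadratic conjugation\<close>

lemma (in constants) CHAR_eq: "CHAR('l) = CHAR('a)"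
proof (rule CHAR_eqI)
  show "of_nat CHAR('a) = (0::'l)" using \<iota>_of_nat[of "CHAR('a)"] by (simp add: \<iota>_simps)
  fix n assume "of_nat n = (0::'l)"
  then have "\<iota> (of_nat n) = 0" by simp
  then show "CHAR('a) dvd n" using \<iota>_simps(9)[of "of_nat n"] of_nat_eq_0_iff_char_dvd[where ?'a='a] by blast
qed

text \<open>An inverse of \<open>u - 2\<close> would be integral over \<open>range (ev u)\<close>,
  so \<open>u - 2\<close> would already be a unit of that polynomial ring, which evaluation at 2
  excludes.\<close>

lemma (in finite_constants) ring_gen_inverse_not_mem:
  fixes X :: "'l set"
  assumes u: "transcendental u"
    and X: "\<And>x. x \<in> X \<Longrightarrow> integral_over (range (ev u)) x"
    and h: "h \<in> ring_gen (insert u (range \<iota> \<union> X))"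
  shows "(u - 2) * h \<noteq> 1"
proof
  assume eq: "(u - 2) * h = 1"
  note A = is_subring_range_ev[of u]
  have two: "u - 2 \<in> range (ev u)"
    using rangeI[of "ev u" "[:-2, 1:]"] by (simp add: \<iota>_simps)
  have "integral_over (range (ev u)) h"
    using integral_over_ring_gen[OF A _ h] X integral_over_self[OF A] range_ev_\<iota> range_ev_self by blast
  from unit_if_inverse_integral[OF A this two eq]
  obtain f where f: "(u - 2) * ev u f = 1" by auto
  then have "ev u ([:-2, 1:] * f - 1) = 0" by (simp add: \<iota>_simps algebra_simps)
  then have "[:-2, 1:] * f - 1 = 0" using u unfolding transcendental_def by blast
  then have "poly ([:-2, 1:] * f - 1) 2 = 0" by simp
  then show False by simp
qed

text \<open>Modulo \<open>u - 2\<close> the ring \<open>R\<close> is reduced, because \<open>a\<^sup>s = a\<close> holds there. Hence a denominator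
  divisible by \<open>u - 2\<close> can be cancelled, and \<open>u - 2\<close> is not ramified in the fraction field of
  \<open>R\<close>, whereas \<open>y\<^sup>2 = (u - 2) (y + 1)\<close> is an Eisenstein equation.\<close>

lemma (in finite_constants) eisenstein_root_not_in_fractions:
  fixes R X :: "'l set"
  assumes R_def: "R = ring_gen (insert u (range \<iota> \<union> X))"
    and u: "transcendental u"
    and X: "\<And>x. x \<in> X \<Longrightarrow> integral_over (range (ev u)) x"
    and s: "s = CHAR('a) ^ n" "n > 0" "\<And>c::'a. c ^ s = c"
    and frob: "\<And>x. x \<in> X \<Longrightarrow> \<exists>h\<in>R. x ^ s - x = (u - 2) * h"
    and y: "y * y = (u - 2) * (y + 1)"
    and a: "a \<in> R" and N: "N \<in> range (ev u)" "N \<noteq> 0"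
  shows "N * y \<noteq> a"
proof
  assume Ny: "N * y = a"
  define \<pi> where "\<pi> = u - 2"
  have R: "is_subring R" by (simp add: R_def is_subring_ring_gen)
  note cl = subring_intros[OF R]
  have gen: "range \<iota> \<subseteq> R" "u \<in> R" "X \<subseteq> R" by (auto simp: R_def intro: ring_gen_superset)
  have evR: "ev u f \<in> R" for f by (rule ev_in_subring[OF R gen(1,2)])
  have \<pi>: "\<pi> = ev u [:-2, 1:]" by (simp add: \<pi>_def \<iota>_simps)
  then have \<pi>R: "\<pi> \<in> R" using evR by metis
  have nounit: "\<pi> * h \<noteq> 1" if "h \<in> R" for h
    using ring_gen_inverse_not_mem[OF u X] that by (simp add: R_def \<pi>_def)
  have \<pi>0: "\<pi> \<noteq> 0"
  proof
    assume "\<pi> = 0"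
    then have "[:-2, 1:] = (0::'a poly)" using u \<pi> unfolding transcendental_def by metis
    then show False by simp
  qed
  have CHAR: "prime CHAR('l)" "s = CHAR('l) ^ n" using CHAR_prime_finite[where ?'a='a] s CHAR_eq by auto
  have s2: "s \<ge> 2"
    using prime_ge_2_nat[OF CHAR(1)] s(2) CHAR(2) self_le_power[of "CHAR('l)" n] by simp
  \<comment> \<open>Frobenius is additive, so the elements with \<open>x ^ s\<close> congruent to
    \<open>x\<close> modulo \<open>\<pi>\<close> form a subring; testing the generators then covers
    all of \<open>R\<close>.\<close>
  have "is_subring {x \<in> R. \<exists>h\<in>R. x ^ s - x = \<pi> * h}"
  proof (rule is_subringI)
    show "1 \<in> {x \<in> R. \<exists>h\<in>R. x ^ s - x = \<pi> * h}" using cl(1,2) by auto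
    fix b c assume "b \<in> {x \<in> R. \<exists>h\<in>R. x ^ s - x = \<pi> * h}" "c \<in> {x \<in> R. \<exists>h\<in>R. x ^ s - x = \<pi> * h}"
    then obtain h k where bc: "b \<in> R" "c \<in> R" "h \<in> R" "k \<in> R"
      "b ^ s - b = \<pi> * h" "c ^ s - c = \<pi> * k" by auto
    have "(b - c) ^ s - (b - c) = (b ^ s - b) - (c ^ s - c)"
      using frobenius_power_diff[OF CHAR, of b c] by simp
    also have "\<dots> = \<pi> * (h - k)" unfolding bc(5,6) by (simp add: algebra_simps)
    finally show "b - c \<in> {x \<in> R. \<exists>h\<in>R. x ^ s - x = \<pi> * h}" using bc cl(3) by auto
    have "(b * c) ^ s - b * c = (b ^ s - b) * c ^ s + b * (c ^ s - c)"
      by (simp add: power_mult_distrib algebra_simps)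
    also have "\<dots> = \<pi> * (h * c ^ s + b * k)" unfolding bc(5,6) by (simp add: algebra_simps)
    finally have "(b * c) ^ s - b * c = \<pi> * (h * c ^ s + b * k)" .
    moreover have "h * c ^ s + b * k \<in> R" using bc by (intro cl)
    ultimately show "b * c \<in> {x \<in> R. \<exists>h\<in>R. x ^ s - x = \<pi> * h}" using bc cl(4) by blast
  qed
  moreover have "insert u (range \<iota> \<union> X) \<subseteq> {x \<in> R. \<exists>h\<in>R. x ^ s - x = \<pi> * h}"
  proof -
    have "\<iota> c ^ s - \<iota> c = \<pi> * 0" for c using s(3) by (simp flip: \<iota>_simps(7))
    moreover have "u ^ s - u = \<pi> * (\<pi> ^ (s - 1) - 1)"
    proof -
      have "(2::'l) ^ s = 2" using arg_cong[OF s(3)[of 2], of \<iota>] by (simp add: \<iota>_simps)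
      then have "u ^ s - u = \<pi> ^ s - \<pi>"
        using frobenius_power_diff[OF CHAR, of u 2] by (simp add: \<pi>_def)
      also have "\<pi> ^ s = \<pi> * \<pi> ^ (s - 1)" using s2 by (cases s) auto
      finally show ?thesis by (simp add: right_diff_distrib)
    qed
    moreover have "\<pi> ^ (s - 1) - 1 \<in> R" using \<pi>R by (intro cl)
    ultimately show ?thesis using gen frob cl(2) unfolding \<pi>_def[symmetric] by blast
  qed
  ultimately have "R \<subseteq> {x \<in> R. \<exists>h\<in>R. x ^ s - x = \<pi> * h}"
    using ring_gen_minimal unfolding R_def by blast
  then have reduced: "\<exists>h\<in>R. b ^ s - b = \<pi> * h" if "b \<in> R" for b using that by blast
  \<comment> \<open>Reducedness at work: as \<open>s \<ge> 2\<close>, \<open>\<pi>\<close> divides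
    \<open>b ^ s\<close> together with \<open>b * b\<close>, and \<open>b ^ s\<close> is congruent
    to \<open>b\<close>.\<close>
  have div_\<pi>: "\<exists>c\<in>R. b = \<pi> * c" if b: "b \<in> R" and b2: "h \<in> R" "b * b = \<pi> * h" for b h
  proof -
    obtain k where k: "k \<in> R" "b ^ s - b = \<pi> * k" using reduced[OF b] by blast
    obtain j where "s = Suc (Suc j)" using s2 by (metis add_2_eq_Suc le_Suc_ex)
    then have "b ^ s = b * b * b ^ (s - 2)" by simp
    then have "b = \<pi> * (h * b ^ (s - 2) - k)" using k(2) b2(2) by (simp add: algebra_simps)
    moreover have "h * b ^ (s - 2) - k \<in> R" using b b2 k by (intro cl)
    ultimately show ?thesis by blast
  qed
  \<comment> \<open>Induction on the power \<open>d\<close> of \<open>\<pi>\<close> in the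
    denominator. Each step cancels one factor; at \<open>d = 0\<close> the denominator has the
    nonzero residue \<open>poly f 2\<close>, against the Eisenstein equation.\<close>
  have descent: False if "\<pi> ^ d * ev u f * y = b" "b \<in> R" "poly f 2 \<noteq> 0" for d f b
    using that
  proof (induction d arbitrary: b)
    case 0
    define n where "n = ev u f"
    have nR: "n \<in> R" by (simp add: n_def evR)
    have b: "b = n * y" using 0 by (simp add: n_def)
    have "b * b = n * n * (y * y)" by (simp add: b)
    also have "\<dots> = \<pi> * (n * (b + n))" unfolding y \<pi>_def[symmetric] by (simp add: b algebra_simps)
    finally have bb: "b * b = \<pi> * (n * (b + n))" .
    moreover have "n * (b + n) \<in> R" using nR 0(2) by (intro cl)
    ultimately obtain c where c: "c \<in> R" "b = \<pi> * c" using div_\<pi>[OF 0(2)] by blast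
    \<comment> \<open>Substituting \<open>b = \<pi> * c\<close> and cancelling once shows that
      \<open>\<pi>\<close> divides \<open>n * n\<close>.\<close>
    have "\<pi> * (\<pi> * (c * c)) = \<pi> * (n * (\<pi> * c + n))" using bb unfolding c(2) by (simp add: mult_ac)
    then have "\<pi> * (c * c) = n * (\<pi> * c + n)" using \<pi>0 by simp
    then have nn: "n * n = \<pi> * (c * c - n * c)" by (simp add: algebra_simps)
    define e where "e = \<iota> (poly f 2)"
    have e: "e \<noteq> 0" using 0(3) by (simp add: e_def \<iota>_simps)
    obtain h where h: "h \<in> R" "ev u f - ev 2 f = (u - 2) * h"
    proof -
      have "2 \<in> R" using gen(1) \<iota>_numeral by (metis UNIV_I image_subset_iff)
      then show ?thesis using ev_diff_factor[OF R gen(1,2)] that by blast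
    qed
    have "ev 2 f = e" using ev_\<iota>[of 2 f] by (simp add: e_def)
    then have n: "n = e + \<pi> * h" using h(2) by (simp add: n_def \<pi>_def algebra_simps)
    \<comment> \<open>The denominator \<open>n\<close> is congruent to the nonzero constant
      \<open>e\<close>, so divisibility of \<open>n * n\<close> would make \<open>\<pi>\<close> a
      unit.\<close>
    have "e * e = n * n - \<pi> * h * (e + n)" unfolding n by (simp add: algebra_simps)
    also have "\<dots> = \<pi> * (c * c - n * c - h * (e + n))" unfolding nn by (simp add: algebra_simps)
    finally have eq: "\<pi> * (inverse (e * e) * (c * c - n * c - h * (e + n))) = 1"
      using e by (simp add: field_simps)
    have "inverse (e * e) \<in> R"
    proof -
      have "inverse (e * e) = \<iota> (inverse (poly f 2 * poly f 2))" by (simp add: e_def \<iota>_simps)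
      then show ?thesis using gen(1) by auto
    qed
    moreover have "e \<in> R" using gen(1) by (auto simp: e_def)
    ultimately have "inverse (e * e) * (c * c - n * c - h * (e + n)) \<in> R" using c h nR by (intro cl)
    with eq show False using nounit by blast
  next
    case (Suc d)
    define n where "n = \<pi> ^ Suc d * ev u f"
    have nR: "n \<in> R" unfolding n_def using \<pi>R evR by (intro cl)
    have b: "b = n * y" using Suc.prems(1) by (simp add: n_def)
    have "b * b = n * n * (y * y)" by (simp add: b)
    also have "\<dots> = \<pi> * (n * (b + n))" unfolding y \<pi>_def[symmetric] by (simp add: b algebra_simps)
    finally have bb: "b * b = \<pi> * (n * (b + n))" .
    moreover have "n * (b + n) \<in> R" using nR Suc.prems(2) by (intro cl)
    ultimately obtain c where c: "c \<in> R" "b = \<pi> * c" using div_\<pi>[OF Suc.prems(2)] by blast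
    have "\<pi> * (\<pi> ^ d * ev u f * y) = \<pi> * c" using Suc.prems(1) c(2) by (simp add: mult_ac)
    then have "\<pi> ^ d * ev u f * y = c" using \<pi>0 by simp
    then show ?case using Suc.IH c(1) Suc.prems(3) by blast
  qed
  obtain f where f: "N = ev u f" using N by auto
  then have "f \<noteq> 0" using N by auto
  \<comment> \<open>Splitting off the exact power of \<open>[:-2, 1:]\<close> supplies the exponent
    for the descent and a cofactor not vanishing at 2.\<close>
  from order_decomp[OF this, of 2] obtain q where
    q: "f = [:-2, 1:] ^ Polynomial.order 2 f * q" "\<not> [:-2, 1:] dvd q" by blast
  have "\<pi> ^ Polynomial.order 2 f * ev u q * y = a"
    using Ny unfolding f by (subst (asm) q(1)) (simp add: \<pi>)
  moreover have "poly q 2 \<noteq> 0" using q(2) poly_eq_0_iff_dvd[of q 2] by simp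
  ultimately show False using descent a by blast
qed

text \<open>Denominators from \<open>A\<close> suffice: \<open>inv\<close> lets the inverse of
  \<open>a / N\<close> be written as \<open>(N * b) / (a * b)\<close>.\<close>

lemma is_subfield_fractions:
  fixes R :: "'a::field set"
  assumes A: "is_subring A" and R: "is_subring R" "A \<subseteq> R"
    and inv: "\<And>a. a \<in> R \<Longrightarrow> a \<noteq> 0 \<Longrightarrow> \<exists>b\<in>R. a * b \<in> A \<and> a * b \<noteq> 0"
  shows "is_subfield {a / N |a N. a \<in> R \<and> N \<in> A \<and> N \<noteq> 0}" (is "is_subfield ?E")
proof -
  have mem: "a / N \<in> ?E" if "a \<in> R" "N \<in> A" "N \<noteq> 0" for a N using that by blast
  have "x + y \<in> ?E \<and> x * y \<in> ?E" if "x \<in> ?E" "y \<in> ?E" for x y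
  proof -
    from that obtain a b N P where *: "x = a / N" "y = b / P" "a \<in> R" "b \<in> R" "N \<in> A" "P \<in> A" "N \<noteq> 0" "P \<noteq> 0"
      by auto
    have "x + y = (a * P + b * N) / (N * P)" using * by (simp add: field_simps)
    moreover have "a * P + b * N \<in> R" using * R by (intro subring_intros[OF R(1)]) auto
    moreover have "N * P \<in> A" using * by (intro subring_intros[OF A])
    ultimately have "x + y \<in> ?E" using mem[of "a * P + b * N" "N * P"] * by simp
    moreover have "x * y = (a * b) / (N * P)" using * by simp
    then have "x * y \<in> ?E" using mem[of "a * b" "N * P"] * subring_mult[OF A] subring_mult[OF R(1)] by simp
    ultimately show ?thesis ..
  qed
  moreover have "- x \<in> ?E \<and> inverse x \<in> ?E" if "x \<in> ?E" for x
  proof -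
    from that obtain a N where *: "x = a / N" "a \<in> R" "N \<in> A" "N \<noteq> 0" by auto
    have "- x \<in> ?E" using mem[of "- a" N] * subring_uminus[OF R(1)] by simp
    moreover have "inverse x \<in> ?E"
    proof (cases "a = 0")
      case True then show ?thesis using that * by simp
    next
      case False
      then obtain b where b: "b \<in> R" "a * b \<in> A" "a * b \<noteq> 0" using inv * by blast
      have "inverse x = (N * b) / (a * b)" using b(3) unfolding *(1) by simp
      then show ?thesis using mem[of "N * b" "a * b"] b * R subring_mult[OF R(1)] by auto
    qed
    ultimately show ?thesis ..
  qed
  moreover have "0 \<in> ?E" "1 \<in> ?E"
    using mem[of 0 1] mem[of 1 1] subring_one[OF A] subring_one[OF R(1)] subring_zero[OF R(1)] by simp_all
  ultimately show ?thesis unfolding is_subfield_def by blast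
qed

text \<open>Both \<open>\<alpha>\<close> and \<open>inverse \<alpha>\<close> solve z^2 - u z + 1 = 0
  over \<open>E\<close>. Hence the combinations \<open>a + b * \<alpha>\<close> already fill the
  whole field, and exchanging the two solutions is an automorphism.\<close>

lemma quadratic_swap:
  fixes \<alpha> :: "'l::field"
  assumes E: "is_subfield E" and \<alpha>: "\<alpha> \<notin> E" "\<alpha> + inverse \<alpha> \<in> E"
    and gen: "\<And>S. is_subfield S \<Longrightarrow> E \<subseteq> S \<Longrightarrow> \<alpha> \<in> S \<Longrightarrow> S = UNIV"
  obtains \<sigma> where "bij \<sigma>" "is_field_hom \<sigma>" "\<And>z. z \<in> E \<Longrightarrow> \<sigma> z = z" "\<sigma> \<alpha> = inverse \<alpha>" "\<sigma> (inverse \<alpha>) = \<alpha>"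
proof -
  have E0: "0 \<in> E" "1 \<in> E" using E by (auto simp: is_subfield_def)
  have cl1: "x + y \<in> E" "x * y \<in> E" if "x \<in> E" "y \<in> E" for x y
    using E that by (auto simp: is_subfield_def)
  have cl2: "- x \<in> E" "inverse x \<in> E" if "x \<in> E" for x
    using E that by (auto simp: is_subfield_def)
  have cl3: "x - y \<in> E" if "x \<in> E" "y \<in> E" for x y
    using cl1(1)[of x "- y"] cl2(1)[of y] that by simp
  note cl = cl1 cl2 cl3
  define u where "u = \<alpha> + inverse \<alpha>"
  have \<alpha>0: "\<alpha> \<noteq> 0" using \<alpha>(1) E0 by auto
  have u: "u \<in> E" using \<alpha>(2) by (simp add: u_def)
  have inv: "inverse \<alpha> = u - \<alpha>" by (simp add: u_def)
  have sq: "\<alpha> * \<alpha> = u * \<alpha> - 1" using \<alpha>0 by (simp add: u_def algebra_simps)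
  \<comment> \<open>Two different coordinate pairs would express \<open>\<alpha>\<close> as a
    quotient in \<open>E\<close>. This makes \<open>\<sigma>\<close> independent of the coordinates
    chosen.\<close>
  have uniq: "a = c \<and> b = d" if "a + b * \<alpha> = c + d * \<alpha>" "a \<in> E" "b \<in> E" "c \<in> E" "d \<in> E" for a b c d
  proof (cases "b = d")
    case False
    have "(b - d) * \<alpha> = c - a" using that(1) by (simp add: algebra_simps)
    then have "\<alpha> = (c - a) * inverse (b - d)" using False by (simp add: field_simps)
    also have "\<dots> \<in> E" using that by (intro cl)
    finally show ?thesis using \<alpha>(1) by simp
  qed (use that in auto)
  define S where "S = {a + b * \<alpha> |a b. a \<in> E \<and> b \<in> E}"
  have memS: "a + b * \<alpha> \<in> S" if "a \<in> E" "b \<in> E" for a b using that by (auto simp: S_def)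
  have mult: "(a + b * \<alpha>) * (c + d * \<alpha>) = (a * c - b * d) + (a * d + b * c + b * d * u) * \<alpha>" for a b c d
  proof -
    have "(a + b * \<alpha>) * (c + d * \<alpha>) = a * c + (a * d + b * c) * \<alpha> + b * d * (\<alpha> * \<alpha>)" by (simp add: algebra_simps)
    then show ?thesis unfolding sq by (simp add: algebra_simps)
  qed
  have "is_subfield S"
    unfolding is_subfield_def
  proof (intro conjI ballI)
    show "0 \<in> S" "1 \<in> S" using memS[of 0 0] memS[of 1 0] E0 by simp_all
    fix x assume "x \<in> S"
    then obtain a b where x: "x = a + b * \<alpha>" "a \<in> E" "b \<in> E" by (auto simp: S_def)
    show "- x \<in> S" using memS[of "- a" "- b"] x cl by (simp add: algebra_simps)
    show "inverse x \<in> S"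
    proof (cases "x = 0")
      case True then show ?thesis using memS[of 0 0] E0 by simp
    next
      case False
      \<comment> \<open>\<open>N\<close> is the norm of \<open>x\<close>; it lies in
        \<open>E\<close> and is nonzero, so the conjugate divided by it inverts
        \<open>x\<close>.\<close>
      define N where "N = a * a + a * b * u + b * b"
      have N: "x * (a + b * inverse \<alpha>) = N"
        using \<alpha>0 by (simp add: x N_def u_def field_simps)
      have "N \<noteq> 0"
      proof
        assume "N = 0"
        then have eq: "a + b * inverse \<alpha> = 0" using N False by simp
        show False
        proof (cases "b = 0")
          case True then show False using eq False x by simp
        next
          case b: False
          have a: "a = - (b * inverse \<alpha>)" using eq by (simp add: add_eq_0_iff2)
          have "\<alpha> = - (b * inverse a)" unfolding a using b \<alpha>0 by simp
          moreover have "- (b * inverse a) \<in> E" using x by (intro cl)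
          ultimately show False using \<alpha>(1) by simp
        qed
      qed
      then have "inverse x = (a + b * inverse \<alpha>) * inverse N"
        using N False by (simp add: field_simps)
      also have "\<dots> = (a + b * u) * inverse N + (- (b * inverse N)) * \<alpha>" by (simp add: inv algebra_simps)
      also have "\<dots> \<in> S"
      proof (rule memS)
        have "N \<in> E" unfolding N_def using x u by (intro cl)
        then show "(a + b * u) * inverse N \<in> E" "- (b * inverse N) \<in> E" using x u by (auto intro!: cl)
      qed
      finally show ?thesis .
    qed
    fix y assume "y \<in> S"
    then obtain c d where y: "y = c + d * \<alpha>" "c \<in> E" "d \<in> E" by (auto simp: S_def)
    have "x + y = (a + c) + (b + d) * \<alpha>" by (simp add: x y algebra_simps)
    also have "\<dots> \<in> S" using x y by (intro memS cl)
    finally show "x + y \<in> S" .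
    have "a * c - b * d \<in> E" "a * d + b * c + b * d * u \<in> E" using x y u by (auto intro!: cl)
    then show "x * y \<in> S" unfolding x(1) y(1) mult by (rule memS)
  qed
  moreover have "E \<subseteq> S" using memS[OF _ E0(1)] by auto
  moreover have "\<alpha> \<in> S" using memS[OF E0] by simp
  ultimately have "S = UNIV" by (rule gen)
  then have "\<forall>z. \<exists>a b. a \<in> E \<and> b \<in> E \<and> z = a + b * \<alpha>" unfolding S_def by blast
  then obtain A B where AB: "\<And>z. A z \<in> E" "\<And>z. B z \<in> E" "\<And>z. z = A z + B z * \<alpha>" by metis
  define \<sigma> where "\<sigma> z = A z + B z * inverse \<alpha>" for z
  have \<sigma>: "\<sigma> (a + b * \<alpha>) = a + b * inverse \<alpha>" if "a \<in> E" "b \<in> E" for a b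
    using uniq[OF AB(3)[symmetric, of "a + b * \<alpha>"] AB(1,2) that] by (simp add: \<sigma>_def)
  have \<sigma>E: "\<sigma> z = z" if "z \<in> E" for z using \<sigma>[OF that E0(1)] by simp
  have \<sigma>\<alpha>: "\<sigma> \<alpha> = inverse \<alpha>" using \<sigma>[OF E0] by simp
  have add: "\<sigma> (x + y) = \<sigma> x + \<sigma> y" for x y
  proof -
    have "x + y = (A x + A y) + (B x + B y) * \<alpha>" using AB(3)[of x] AB(3)[of y] by (simp add: algebra_simps)
    then show ?thesis using \<sigma>[of "A x + A y" "B x + B y"] AB(1,2) cl(1) by (simp add: \<sigma>_def algebra_simps)
  qed
  have mul: "\<sigma> (x * y) = \<sigma> x * \<sigma> y" for x y
  proof -
    have sq': "inverse \<alpha> * inverse \<alpha> = u * inverse \<alpha> - 1" using \<alpha>0 by (simp add: u_def algebra_simps)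
    have "x * y = (A x * A y - B x * B y) + (A x * B y + B x * A y + B x * B y * u) * \<alpha>"
      using mult[of "A x" "B x" "A y" "B y"] unfolding AB(3)[symmetric] .
    moreover have "A x * A y - B x * B y \<in> E" "A x * B y + B x * A y + B x * B y * u \<in> E"
      by (auto intro!: cl AB u)
    ultimately have "\<sigma> (x * y) = (A x * A y - B x * B y) + (A x * B y + B x * A y + B x * B y * u) * inverse \<alpha>"
      using \<sigma> by metis
    also have "\<dots> = A x * A y + (A x * B y + B x * A y) * inverse \<alpha> + B x * B y * (u * inverse \<alpha> - 1)"
      by (simp add: algebra_simps)
    also have "\<dots> = \<sigma> x * \<sigma> y" unfolding sq'[symmetric] \<sigma>_def by (simp add: algebra_simps)
    finally show ?thesis .
  qed
  have "\<sigma> 0 = 0" "\<sigma> 1 = 1" using \<sigma>E E0 by auto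
  then have hom: "is_field_hom \<sigma>" using add mul by (simp add: is_field_hom_def)
  have \<sigma>inv: "\<sigma> (inverse \<alpha>) = \<alpha>" using is_field_hom_simps(8)[OF hom, of \<alpha>] \<sigma>\<alpha> by simp
  have "\<sigma> (\<sigma> z) = z" for z
  proof -
    have "\<sigma> (\<sigma> z) = A z + B z * \<sigma> (inverse \<alpha>)"
      unfolding \<sigma>_def[of z] add mul using \<sigma>E AB(1,2) by simp
    then show ?thesis using AB(3)[of z] \<sigma>inv by simp
  qed
  then have "bij \<sigma>" using involuntory_imp_bij by blast
  with hom \<sigma>E \<sigma>\<alpha> \<sigma>inv show thesis using that by blast
qed

subsection \<open>The roots of the family\<close>

text \<open>A repeated linear factor would make \<open>p\<close> and its derivative vanish together,
  so the multiset of zeros has no repetitions and its size is the degree.\<close>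

lemma card_roots_if_separable:
  fixes p :: "'l::field poly"
  assumes "splits p" "p \<noteq> 0" and sep: "\<And>x. poly p x = 0 \<Longrightarrow> poly (pderiv p) x \<noteq> 0"
  shows "card {x. poly p x = 0} = degree p"
proof -
  obtain A where A: "p = Polynomial.smult (lead_coeff p) (\<Prod>a\<in>#A. [:-a, 1:])"
    using assms(1) by (auto simp: splits_def)
  define q where "q = (\<Prod>a\<in>#A. [:-a, 1:])"
  define c where "c = lead_coeff p"
  have c: "c \<noteq> 0" using assms(2) by (simp add: c_def)
  have p: "p = Polynomial.smult c q" using A by (simp add: q_def c_def)
  have roots: "{x. poly p x = 0} = set_mset A"
    using c by (auto simp: p q_def poly_prod_mset prod_mset_zero_iff)
  have "degree q = size A"
    unfolding q_def
  proof (induction A)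
    case (add a A)
    have "(\<Prod>a\<in>#A. [:-a, 1:]) \<noteq> 0" by (auto simp: prod_mset_zero_iff)
    then have "degree ([:-a, 1:] * (\<Prod>a\<in>#A. [:-a, 1:])) = 1 + size A"
      using add by (subst degree_mult_eq) auto
    then show ?case by simp
  qed simp
  then have deg: "degree p = size A" using p c by simp
  have le1: "count A a \<le> 1" for a
  proof (rule ccontr)
    assume "\<not> count A a \<le> 1"
    then have "{#a, a#} \<subseteq># A" by (auto simp: subseteq_mset_def)
    then obtain B where B: "A = {#a, a#} + B" by (auto simp: subset_mset.le_iff_add)
    define l where "l = [:-a, 1:]"
    have "p = l * (l * Polynomial.smult c (\<Prod>a\<in>#B. [:-a, 1:]))"
      by (simp add: p q_def B l_def del: mult_pCons_left)
    moreover have "poly l a = 0" by (simp add: l_def)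
    ultimately have "poly p a = 0" "poly (pderiv p) a = 0" by (simp_all add: pderiv_mult pderiv_smult)
    then show False using sep by blast
  qed
  have "A = mset_set (set_mset A)"
  proof (rule multiset_eqI)
    fix a
    show "count A a = count (mset_set (set_mset A)) a"
    proof (cases "a \<in># A")
      case True
      then have "count A a = 1" using le1[of a] count_greater_zero_iff[of A a] by linarith
      then show ?thesis using True by simp
    qed (simp add: not_in_iff)
  qed
  then have "size A = card (set_mset A)" by (metis size_mset_set)
  then show ?thesis using roots deg by simp
qed

lemma group_galois_group: "Group.group (galois_group \<phi>)"
proof (rule groupI)
  fix x assume "x \<in> carrier (galois_group \<phi>)"
  then have x: "bij x" "is_field_hom x" "x \<circ> \<phi> = \<phi>" by (auto simp: galois_group_def)
  have r: "x (inv_into UNIV x z) = z" for z using x(1) by (simp add: bij_is_surj surj_f_inv_f)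
  have l: "inv_into UNIV x (x z) = z" for z using x(1) by (simp add: bij_is_inj)
  have "inv_into UNIV x (a + b) = inv_into UNIV x a + inv_into UNIV x b" for a b
    using l[of "inv_into UNIV x a + inv_into UNIV x b"] by (simp add: is_field_hom_simps(3)[OF x(2)] r)
  moreover have "inv_into UNIV x (a * b) = inv_into UNIV x a * inv_into UNIV x b" for a b
    using l[of "inv_into UNIV x a * inv_into UNIV x b"] by (simp add: is_field_hom_simps(4)[OF x(2)] r)
  moreover have "inv_into UNIV x 0 = 0" "inv_into UNIV x 1 = 1"
    using l[of 0] l[of 1] by (simp_all add: is_field_hom_simps(1,2)[OF x(2)])
  ultimately have "is_field_hom (inv_into UNIV x)" by (simp add: is_field_hom_def)
  moreover have "inv_into UNIV x \<circ> \<phi> = \<phi>" using x(3) l by (metis comp_apply fun_eq_iff)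
  ultimately show "\<exists>y\<in>carrier (galois_group \<phi>). y \<otimes>\<^bsub>galois_group \<phi>\<^esub> x = \<one>\<^bsub>galois_group \<phi>\<^esub>"
    using x(1) l by (intro bexI[of _ "inv_into UNIV x"]) (auto simp: galois_group_def bij_imp_bij_inv)
qed (auto simp: galois_group_def is_field_hom_def bij_comp fun_eq_iff)

text \<open>Both \<open>x\<close> and \<open>y\<close> are zeros of the quadratic z^2 - (y + 1/y) z
  + 1, whose zeros are y and 1/y.\<close>

lemma reciprocal_pair_eq:
  fixes x y :: "'l::field"
  assumes "x \<noteq> 0" "y \<noteq> 0" "x + inverse x = y + inverse y"
  shows "x = y \<or> x = inverse y"
proof -
  have "(x - y) * (x - inverse y) = x * x - (y + inverse y) * x + 1"
    using assms(2) by (simp add: algebra_simps)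
  also have "\<dots> = 0" using assms(1) by (simp add: assms(3)[symmetric] algebra_simps)
  finally show ?thesis by simp
qed

lemma reciprocal_pair_set_eq_iff: "{x, inverse x} = {y, inverse y} \<longleftrightarrow> x = y \<or> x = inverse (y :: 'l::field)"
  by (auto simp: doubleton_eq_iff)

section \<open>The splitting field and the equation for pair sums\<close>

locale reciprocal_family =
  fixes M :: "'a::{field,finite} poly" and m :: nat and gs :: "'a poly list"
    and \<phi> :: "'a poly fract \<Rightarrow> 'l::field"
  assumes rec: "self_reciprocal M" and deg: "degree M = 2 * m" and M0: "poly M 0 = 1"
    and M: "M = [:-1, 1:] ^ 2 * prod_list gs"
    and dist: "distinct gs"
    and irr: "\<forall>g\<in>set gs. lead_coeff g = 1 \<and> irreducible g \<and> g \<noteq> [:-1, 1:]"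
    and split: "is_splitting_field \<phi> (Mt M m)"
begin

definition emb :: "'a \<Rightarrow> 'l" where "emb c = \<phi> (to_fract [:c:])"

definition T :: 'l where "T = \<phi> tvar"

abbreviation root :: "'l \<Rightarrow> bool" where
  "root x \<equiv> poly (map_poly \<phi> (Mt M m)) x = 0"

lemma \<phi>_hom: "is_field_hom \<phi>"
  using split by (simp add: is_splitting_field_def)

lemmas \<phi>_simps = is_field_hom_simps[OF \<phi>_hom]

sublocale finite_constants emb
proof
  have "[:c + d:] = [:c:] + [:d:]" "[:c * d:] = [:c:] * [:d:]" for c d :: 'a by simp_all
  then show "is_field_hom emb"
    by (simp only: is_field_hom_def emb_def to_fract_add to_fract_mult \<phi>_simps) (simp add: \<phi>_simps flip: one_pCons)
qed

lemma map_poly_Mt: "map_poly \<phi> (Mt M m) = map_poly emb M + monom T m"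
  by (rule poly_eqI) (simp add: Mt_def const_lift_def coeff_map_poly \<phi>_simps emb_def T_def \<iota>_simps)

lemma root_iff_ev: "root x \<longleftrightarrow> ev x M + T * x ^ m = 0"
  by (simp add: map_poly_Mt ev_def poly_monom)

text \<open>On polynomials in t, evaluation at \<open>T\<close> is just \<open>\<phi>\<close>, so
  injectivity of \<open>\<phi>\<close> yields the transcendence of \<open>T\<close>.\<close>

lemma ev_T: "ev T f = \<phi> (to_fract f)"
proof (induction f)
  case (pCons c f)
  have "pCons c f = [:c:] + [:0, 1:] * f" by simp
  then have "\<phi> (to_fract (pCons c f)) = emb c + T * \<phi> (to_fract f)"
    by (simp only: to_fract_add to_fract_mult \<phi>_simps emb_def T_def tvar_def)
  then show ?case using pCons by simp
qed (simp add: \<phi>_simps)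

lemma transcendental_T: "transcendental T"
  by (simp add: transcendental_def ev_T \<phi>_simps)

lemma m_pos: "m > 0"
proof -
  have "M \<noteq> 0" using M0 by auto
  then have "prod_list gs \<noteq> 0" using M by (metis mult_zero_right)
  then have "degree M = 2 + degree (prod_list gs)"
    using M by (simp add: degree_mult_eq degree_power_eq)
  then show ?thesis using deg by simp
qed

lemma monic_M: "lead_coeff M = 1"
  using rec by (simp add: self_reciprocal_def)

lemma degree_Mt: "degree (map_poly \<phi> (Mt M m)) = 2 * m"
  and lead_coeff_Mt: "lead_coeff (map_poly \<phi> (Mt M m)) = 1"
proof -
  have d: "degree (map_poly emb M) = 2 * m"
    unfolding deg[symmetric] by (subst degree_map_poly) (use monic_M in \<open>auto simp: \<iota>_simps\<close>)
  have "degree (monom T m) < 2 * m" using degree_monom_le[of T m] m_pos by linarith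
  then show "degree (map_poly \<phi> (Mt M m)) = 2 * m"
    unfolding map_poly_Mt using d by (simp add: degree_add_eq_left)
  then show "lead_coeff (map_poly \<phi> (Mt M m)) = 1"
    using monic_M deg m_pos by (simp add: map_poly_Mt coeff_map_poly \<iota>_simps)
qed

lemma root_nonzero: "root x \<Longrightarrow> x \<noteq> 0"
proof
  assume "root x" "x = 0"
  moreover have "ev 0 M = 1" using ev_\<iota>[of 0 M] M0 by (simp add: \<iota>_simps)
  ultimately show False using m_pos by (simp add: root_iff_ev power_0_left)
qed

text \<open>Palindromicity gives a polynomial in x + 1/x. It vanishes at 2 = 1 + 1/1 because 1 is a
  zero of \<open>M\<close>, so \<open>[:-2, 1:]\<close> splits off.\<close>

lemma Q_exists: "\<exists>Q. \<forall>x. x \<noteq> 0 \<longrightarrow> ev x M = x ^ m * ev (x + inverse x) ([:-2, 1:] * Q)"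
proof -
  have "M = reflect_poly M" using rec M0 by (simp add: self_reciprocal_def)
  then have "coeff M i = coeff M (2 * m - i)" if "i \<le> 2 * m" for i
    using that deg by (metis coeff_reflect_poly not_less)
  then obtain P where P: "\<And>x. x \<noteq> 0 \<Longrightarrow> ev x M = x ^ m * ev (x + inverse x) P"
    using palindromic_in_sum_with_inverse[of M m] deg order_refl by metis
  have "ev 1 M = 0" using M by (simp add: \<iota>_simps)
  then have "emb (poly P 2) = 0" using P[of 1] ev_\<iota>[of 2 P] by simp
  then have "[:-2, 1:] dvd P" by (simp add: \<iota>_simps poly_eq_0_iff_dvd)
  then obtain Q where "P = [:-2, 1:] * Q" by (rule dvdE)
  then show ?thesis using P by blast
qed

definition Q :: "'a poly" where
  "Q = (SOME Q. \<forall>x. x \<noteq> 0 \<longrightarrow> ev x M = x ^ m * ev (x + inverse x) ([:-2, 1:] * Q))"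

lemma ev_M: "x \<noteq> 0 \<Longrightarrow> ev x M = x ^ m * ((x + inverse x - 2) * ev (x + inverse x) Q)"
  using someI_ex[OF Q_exists, folded Q_def] by (simp add: \<iota>_simps left_diff_distrib)

text \<open>Dividing by \<open>x ^ m\<close> leaves an equation in the pair sum alone. It gives
  symmetry under inversion and shows \<open>T\<close> to be a polynomial in the pair sum.\<close>

lemma root_iff: "root x \<longleftrightarrow> x \<noteq> 0 \<and> (x + inverse x - 2) * ev (x + inverse x) Q = - T"
proof (cases "x = 0")
  case True
  then show ?thesis using root_nonzero by blast
next
  case False
  have "root x \<longleftrightarrow> x ^ m * ((x + inverse x - 2) * ev (x + inverse x) Q + T) = 0"
    by (simp only: root_iff_ev ev_M[OF False]) (simp add: algebra_simps)
  then show ?thesis using False by (simp add: eq_neg_iff_add_eq_0)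
qed

lemma root_inverse: "root x \<Longrightarrow> root (inverse x)"
  by (simp add: root_iff add.commute)

lemma T_in_range_ev: "root x \<Longrightarrow> T \<in> range (ev (x + inverse x))"
proof -
  assume "root x"
  then have "T = - ((x + inverse x - 2) * ev (x + inverse x) Q)" by (simp add: root_iff)
  also have "\<dots> = ev (x + inverse x) (- ([:-2, 1:] * Q))" by (simp add: \<iota>_simps left_diff_distrib)
  finally show ?thesis by (rule range_eqI)
qed

lemma transcendental_pair_sum: "root x \<Longrightarrow> transcendental (x + inverse x)"
  using transcendental_if_in_range_ev[OF transcendental_T T_in_range_ev] .

lemma transcendental_root: "root x \<Longrightarrow> transcendental x"
  using transcendental_if_sum_with_inverse transcendental_pair_sum root_nonzero by blast

lemma root_neq_inverse:
  assumes "root x" shows "x \<noteq> inverse x"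
proof
  assume "x = inverse x"
  then have "x * x = 1" using root_nonzero[OF assms] by (metis right_inverse)
  then have "ev x [:-1, 0, 1:] = 0" by (simp add: \<iota>_simps)
  then have "[:-1, 0, 1:] = (0 :: 'a poly)"
    using transcendental_root[OF assms] unfolding transcendental_def by blast
  then show False by simp
qed

text \<open>At a multiple root \<open>T\<close> can be eliminated, and \<open>x\<close> would
  satisfy the nonzero polynomial of \<open>wronskian_nonzero\<close>, against transcendence.\<close>

lemma card_roots: "card {x. root x} = 2 * m"
proof -
  have "poly (pderiv (map_poly \<phi> (Mt M m))) x \<noteq> 0" if x: "root x" for x
  proof
    assume der: "poly (pderiv (map_poly \<phi> (Mt M m))) x = 0"
    have "pderiv (map_poly emb M) = map_poly emb (pderiv M)"
    proof (rule poly_eqI)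
      fix i
      have "emb (of_nat (Suc i) * coeff M (Suc i)) = of_nat (Suc i) * emb (coeff M (Suc i))"
        by (simp only: \<iota>_simps \<iota>_of_nat)
      then show "coeff (pderiv (map_poly emb M)) i = coeff (map_poly emb (pderiv M)) i"
        by (simp only: coeff_pderiv coeff_map_poly \<iota>_simps(1))
    qed
    then have d: "ev x (pderiv M) + of_nat m * T * x ^ (m - 1) = 0"
      using der by (simp add: map_poly_Mt pderiv_add pderiv_monom poly_monom ev_def)
    have "x * x ^ (m - 1) = x ^ m" using m_pos by (cases m) auto
    then have "ev x ([:0, 1:] * pderiv M - Polynomial.smult (of_nat m) M) =
        x * (ev x (pderiv M) + of_nat m * T * x ^ (m - 1)) - of_nat m * (ev x M + T * x ^ m)"
      by (simp add: \<iota>_simps algebra_simps)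
    also have "\<dots> = 0" using d x by (simp add: root_iff_ev)
    finally show False
      using transcendental_root[OF x] wronskian_nonzero[OF deg M0 M dist irr]
      unfolding transcendental_def by blast
  qed
  moreover have "map_poly \<phi> (Mt M m) \<noteq> 0" using lead_coeff_Mt by force
  moreover have "splits (map_poly \<phi> (Mt M m))" using split by (simp add: is_splitting_field_def)
  ultimately show ?thesis
    using card_roots_if_separable[of "map_poly \<phi> (Mt M m)"] degree_Mt by metis
qed

text \<open>The field \<open>E\<close> generated by the pair sum and the other roots omits
  \<open>\<alpha>\<close> by the Eisenstein argument, so conjugation over \<open>E\<close> swaps one
  pair and fixes all other roots.\<close>

lemma transposition:
  assumes \<alpha>: "root \<alpha>"
  shows "\<exists>\<sigma>\<in>carrier (galois_group \<phi>). \<sigma> \<alpha> = inverse \<alpha> \<and> \<sigma> (inverse \<alpha>) = \<alpha> \<and>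
      (\<forall>\<beta>. root \<beta> \<and> \<beta> \<noteq> \<alpha> \<and> \<beta> \<noteq> inverse \<alpha> \<longrightarrow> \<sigma> \<beta> = \<beta>)"
proof -
  define u where "u = \<alpha> + inverse \<alpha>"
  define X where "X = {\<beta>. root \<beta> \<and> \<beta> \<noteq> \<alpha> \<and> \<beta> \<noteq> inverse \<alpha>}"
  define R where "R = ring_gen (insert u (range emb \<union> X))"
  have R: "is_subring R" by (simp add: R_def is_subring_ring_gen)
  note cl = subring_intros[OF R]
  have gen: "range emb \<subseteq> R" "u \<in> R" "X \<subseteq> R" by (auto simp: R_def intro: ring_gen_superset)
  note A = is_subring_range_ev[of u]
  have AR: "range (ev u) \<subseteq> R" using ev_in_subring[OF R gen(1,2)] by blast
  have \<alpha>0: "\<alpha> \<noteq> 0" by (rule root_nonzero[OF \<alpha>])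
  have u: "transcendental u" unfolding u_def by (rule transcendental_pair_sum[OF \<alpha>])
  have T: "T \<in> range (ev u)" unfolding u_def by (rule T_in_range_ev[OF \<alpha>])
  have int: "integral_over (range (ev u)) \<beta>" if "\<beta> \<in> X" for \<beta>
    unfolding integral_over_def
  \<comment> \<open>\<open>Mt M m\<close> itself witnesses integrality: it is monic, and its
    coefficients involve only constants and \<open>T\<close>, a polynomial in
    \<open>u\<close>.\<close>
  proof (intro exI[of _ "map_poly \<phi> (Mt M m)"] conjI allI)
    fix i
    have "emb (coeff M i) + (if i = m then T else 0) \<in> range (ev u)"
      using T by (intro subring_add[OF A] range_ev_\<iota>) (auto intro: subring_zero[OF A])
    then show "coeff (map_poly \<phi> (Mt M m)) i \<in> range (ev u)"
      by (auto simp: map_poly_Mt coeff_map_poly \<iota>_simps)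
  qed (use that lead_coeff_Mt in \<open>auto simp: X_def\<close>)
  obtain n where n: "n > 0" "\<And>c::'a. c ^ (CHAR('a) ^ n) = c"
    "prod_list gs dvd [:0, 1:] ^ (CHAR('a) ^ n) - [:0, 1:]"
    using frobenius_exponent[OF dist] irr by metis
  define s where "s = CHAR('a) ^ n"
  obtain k where k: "[:0, 1:] ^ s - [:0, 1:] = prod_list gs * k" using n(3) unfolding s_def dvd_def by blast
  have frob: "\<exists>h\<in>R. \<beta> ^ s - \<beta> = (u - 2) * h" if \<beta>X: "\<beta> \<in> X" for \<beta>
  proof -
    define v where "v = \<beta> + inverse \<beta>"
    have \<beta>: "root \<beta>" "\<beta> \<noteq> \<alpha>" "\<beta> \<noteq> inverse \<alpha>" using \<beta>X by (auto simp: X_def)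
    have \<beta>0: "\<beta> \<noteq> 0" by (rule root_nonzero[OF \<beta>(1)])
    have "inverse \<beta> \<in> X" using \<beta> root_inverse by (auto simp: X_def)
    then have vR: "v \<in> R" and \<beta>R: "\<beta> \<in> R" unfolding v_def using \<beta>X gen(3) by (auto intro: cl)
    have vu: "v \<noteq> u" using reciprocal_pair_eq[OF \<beta>0 \<alpha>0] \<beta> by (auto simp: v_def u_def)
    obtain h where h: "h \<in> R" "ev v Q - ev u Q = (v - u) * h"
      using ev_diff_factor[OF R gen(1) vR gen(2)] by blast
    have eq: "(v - 2) * ev v Q = (u - 2) * ev u Q" using \<alpha> \<beta>(1) by (simp add: root_iff u_def v_def)
    \<comment> \<open>Both pair sums give the same value in \<open>eq\<close>; cancelling
      \<open>v - u\<close> leaves \<open>ev v Q\<close> as a multiple of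
      \<open>u - 2\<close>.\<close>
    have "(v - u) * ev v Q = (v - 2) * ev v Q - (u - 2) * ev v Q" by (simp add: algebra_simps)
    also have "\<dots> = - (u - 2) * (ev v Q - ev u Q)" unfolding eq by (simp add: algebra_simps)
    also have "\<dots> = (v - u) * (- (u - 2) * h)" unfolding h(2) by simp
    finally have Qv: "ev v Q = - (u - 2) * h" using vu by simp
    have "\<beta> \<noteq> 1"
    proof
      assume "\<beta> = 1"
      then have "ev \<beta> [:-1, 1:] = 0" by (simp add: \<iota>_simps)
      then have "[:-1, 1:] = (0 :: 'a poly)"
        using transcendental_root[OF \<beta>(1)] unfolding transcendental_def by blast
      then show False by simp
    qed
    moreover have "(\<beta> - 1) ^ 2 * ev \<beta> (prod_list gs) = ev \<beta> M" by (subst M) (simp add: \<iota>_simps)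
    moreover have "ev \<beta> M = \<beta> ^ m * ((v - 2) * ev v Q)" unfolding v_def by (rule ev_M[OF \<beta>0])
    moreover have "\<beta> ^ m = \<beta> * \<beta> ^ (m - 1)" using m_pos by (cases m) auto
    \<comment> \<open>With this identity both formulas for \<open>ev \<beta> M\<close> contain
      \<open>(\<beta> - 1) ^ 2\<close>, whose cancellation isolates the product of the irreducible
      factors at \<open>\<beta>\<close>.\<close>
    moreover have "\<beta> * (v - 2) = (\<beta> - 1) ^ 2" using \<beta>0 by (simp add: v_def power2_eq_square algebra_simps)
    ultimately have "(\<beta> - 1) ^ 2 * ev \<beta> (prod_list gs) = (\<beta> - 1) ^ 2 * (\<beta> ^ (m - 1) * ev v Q)"
      by (metis (no_types, lifting) mult.assoc mult.commute)
    then have "ev \<beta> (prod_list gs) = \<beta> ^ (m - 1) * ev v Q" using \<open>\<beta> \<noteq> 1\<close> by simp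
    moreover have "\<beta> ^ s - \<beta> = ev \<beta> (prod_list gs) * ev \<beta> k"
      using arg_cong[OF k, of "ev \<beta>"] by (simp add: \<iota>_simps)
    ultimately have "\<beta> ^ s - \<beta> = \<beta> ^ (m - 1) * (- (u - 2) * h) * ev \<beta> k"
      unfolding Qv by (simp only:)
    then have "\<beta> ^ s - \<beta> = (u - 2) * (- (\<beta> ^ (m - 1) * h * ev \<beta> k))"
      by (simp add: algebra_simps)
    moreover have "- (\<beta> ^ (m - 1) * h * ev \<beta> k) \<in> R"
      using \<beta>R h ev_in_subring[OF R gen(1) \<beta>R] by (intro cl)
    ultimately show ?thesis by blast
  qed
  define E where "E = {a / N |a N. a \<in> R \<and> N \<in> range (ev u) \<and> N \<noteq> 0}"
  have RE: "a \<in> E" if "a \<in> R" for a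
    using that subring_one[OF A] unfolding E_def by (intro CollectI exI[of _ a] exI[of _ 1]) simp
  \<comment> \<open>The Eisenstein equation, with \<open>\<alpha> - 1\<close> in the role of
    \<open>y\<close>.\<close>
  have "(\<alpha> - 1) * (\<alpha> - 1) = (u - 2) * (\<alpha> - 1 + 1)"
    using \<alpha>0 by (simp add: u_def algebra_simps)
  note not_fraction = eisenstein_root_not_in_fractions[OF R_def u int s_def n(1) n(2)[folded s_def] frob this]
  have "\<alpha> \<notin> E"
  proof
    assume "\<alpha> \<in> E"
    then obtain a N where aN: "\<alpha> = a / N" "a \<in> R" "N \<in> range (ev u)" "N \<noteq> 0" by (auto simp: E_def)
    then have "N * (\<alpha> - 1) = a - N" by (simp add: algebra_simps)
    moreover have "a - N \<in> R" using aN AR by (intro cl) auto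
    ultimately show False using not_fraction[of "a - N" N] aN by blast
  qed
  moreover have "is_subfield E"
    unfolding E_def
  proof (rule is_subfield_fractions[OF A R AR])
    fix a assume a: "a \<in> R" "a \<noteq> 0"
    have "integral_over (range (ev u)) x" if "x \<in> insert u (range emb \<union> X)" for x
      using that int integral_over_self[OF A] range_ev_self range_ev_\<iota> by blast
    then have "integral_over (range (ev u)) a"
      using integral_over_ring_gen[OF A] a(1) unfolding R_def by blast
    then show "\<exists>b\<in>R. a * b \<in> range (ev u) \<and> a * b \<noteq> 0"
      by (rule divides_base_element[OF A R AR a])
  qed
  moreover have \<phi>E: "\<phi> z \<in> E" for z
  proof -
    have to: "\<phi> (to_fract a) \<in> range (ev u)" for a
      unfolding ev_T[symmetric] using ev_in_subring[OF A _ T] range_ev_\<iota> by blast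
    obtain a b where z: "z = Fract a b" "b \<noteq> 0" by (cases z)
    then have "\<phi> z = \<phi> (to_fract a) / \<phi> (to_fract b)"
      by (simp add: Fract_conv_to_fract divide_inverse \<phi>_simps)
    moreover have "\<phi> (to_fract b) \<noteq> 0" using z(2) by (simp add: \<phi>_simps)
    ultimately show ?thesis using to AR unfolding E_def by blast
  qed
  moreover have "\<alpha> + inverse \<alpha> \<in> E" using RE gen(2) by (simp add: u_def)
  \<comment> \<open>A subfield containing \<open>E\<close> and \<open>\<alpha>\<close> contains the
    ground field and every root, so minimality of the splitting field applies.\<close>
  moreover have "S = UNIV" if S: "is_subfield S" "E \<subseteq> S" "\<alpha> \<in> S" for S
  proof -
    have "{x. root x} \<subseteq> S"
    proof
      fix x assume "x \<in> {x. root x}"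
      then consider "x = \<alpha>" | "x = inverse \<alpha>" | "x \<in> X" by (auto simp: X_def)
      then show "x \<in> S"
      proof cases
        case 3 then show ?thesis using gen(3) RE S(2) by blast
      qed (use S in \<open>auto simp: is_subfield_def\<close>)
    qed
    moreover have "range \<phi> \<subseteq> S" using \<phi>E S(2) by blast
    ultimately show ?thesis using split S(1) by (simp add: is_splitting_field_def)
  qed
  ultimately obtain \<sigma> where \<sigma>: "bij \<sigma>" "is_field_hom \<sigma>" "\<And>z. z \<in> E \<Longrightarrow> \<sigma> z = z"
    "\<sigma> \<alpha> = inverse \<alpha>" "\<sigma> (inverse \<alpha>) = \<alpha>"
    using quadratic_swap[of E \<alpha>] by metis
  have "\<sigma> \<in> carrier (galois_group \<phi>)"
    using \<sigma> \<phi>E by (auto simp: galois_group_def)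
  moreover have "\<sigma> \<beta> = \<beta>" if "\<beta> \<in> X" for \<beta> using that gen(3) RE \<sigma>(3) by blast
  ultimately show ?thesis using \<sigma>(4,5) by (auto simp: X_def)
qed

end

subsection \<open>The kernel of the action on reciprocal pairs\<close>

context reciprocal_family
begin

lemma galois_fixes:
  assumes "\<sigma> \<in> carrier (galois_group \<phi>)"
  shows "is_field_hom \<sigma>" "\<sigma> (\<phi> z) = \<phi> z"
  using assms by (auto simp: galois_group_def fun_eq_iff)

lemma galois_root:
  assumes "\<sigma> \<in> carrier (galois_group \<phi>)" "root x"
  shows "root (\<sigma> x)"
proof -
  note \<sigma> = galois_fixes[OF assms(1)]
  have "\<sigma> (emb c) = emb c" for c using \<sigma>(2) by (simp add: emb_def)
  then have "\<sigma> (ev x f) = ev (\<sigma> x) f" for f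
    by (induction f) (simp_all add: is_field_hom_simps[OF \<sigma>(1)])
  then have "ev (\<sigma> x) M + T * \<sigma> x ^ m = \<sigma> (ev x M + T * x ^ m)"
    using \<sigma>(2)[of tvar] by (simp add: is_field_hom_simps[OF \<sigma>(1)] T_def)
  also have "\<dots> = 0" using assms(2) is_field_hom_simps(1)[OF \<sigma>(1)] by (simp only: root_iff_ev)
  finally show ?thesis by (simp only: root_iff_ev)
qed

text \<open>The elements on which both maps agree form a subfield, which minimality of the splitting
  field makes everything.\<close>

lemma galois_eqI:
  assumes "\<sigma> \<in> carrier (galois_group \<phi>)" "\<tau> \<in> carrier (galois_group \<phi>)" "\<And>x. root x \<Longrightarrow> \<sigma> x = \<tau> x"
  shows "\<sigma> = \<tau>"
proof -
  note s = is_field_hom_simps[OF galois_fixes(1)[OF assms(1)]]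
    and t = is_field_hom_simps[OF galois_fixes(1)[OF assms(2)]]
  have "is_subfield {z. \<sigma> z = \<tau> z}" by (simp add: is_subfield_def s t)
  moreover have "range \<phi> \<subseteq> {z. \<sigma> z = \<tau> z}" using galois_fixes(2)[OF assms(1)] galois_fixes(2)[OF assms(2)] by auto
  moreover have "{x. root x} \<subseteq> {z. \<sigma> z = \<tau> z}" using assms(3) by auto
  ultimately have "{z. \<sigma> z = \<tau> z} = UNIV" using split by (simp add: is_splitting_field_def)
  then show ?thesis by auto
qed

lemma galois_inverse: "\<sigma> \<in> carrier (galois_group \<phi>) \<Longrightarrow> \<sigma> (inverse x) = inverse (\<sigma> x)"
  using is_field_hom_simps(8)[OF galois_fixes(1)] .

lemma galois_comp:
  "\<sigma> \<in> carrier (galois_group \<phi>) \<Longrightarrow> \<tau> \<in> carrier (galois_group \<phi>) \<Longrightarrow> \<sigma> \<circ> \<tau> \<in> carrier (galois_group \<phi>)"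
  using monoid.m_closed[OF group.is_monoid[OF group_galois_group[of \<phi>]], of \<sigma> \<tau>] by (simp add: galois_group_def)

definition pairs :: "'l set set" where
  "pairs = (\<lambda>x. {x, inverse x}) ` {x. root x}"

lemma finite_roots: "finite {x. root x}"
  using card_roots m_pos card_ge_0_finite by force

lemma card_pairs: "card pairs = m"
proof -
  have U: "\<Union>pairs = {x. root x}" using root_inverse by (auto simp: pairs_def)
  have "2 * card pairs = card (\<Union>pairs)"
  proof (rule card_partition)
    show "finite pairs" "finite (\<Union>pairs)" using finite_roots U by (auto simp: pairs_def)
    show "card c = 2" if "c \<in> pairs" for c using that root_neq_inverse by (auto simp: pairs_def)
    show "c \<inter> d = {}" if "c \<in> pairs" "d \<in> pairs" "c \<noteq> d" for c d
      using that by (auto simp: pairs_def)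
  qed
  then show ?thesis using card_roots U by simp
qed

text \<open>Composing transpositions of different pairs, one for each element of \<open>V\<close>,
  realises every pattern of swaps.\<close>

lemma pair_swaps:
  assumes "V \<subseteq> pairs"
  shows "\<exists>\<sigma>\<in>carrier (galois_group \<phi>). \<forall>x. root x \<longrightarrow> \<sigma> x = (if {x, inverse x} \<in> V then inverse x else x)"
proof -
  have "finite V" using assms finite_roots finite_subset by (auto simp: pairs_def)
  then show ?thesis using assms
  proof (induction V)
    case empty
    have "id \<in> carrier (galois_group \<phi>)" by (simp add: galois_group_def is_field_hom_def)
    then show ?case by (intro bexI[of _ id]) auto
  next
    case (insert c V)
    obtain \<alpha> where \<alpha>: "root \<alpha>" "c = {\<alpha>, inverse \<alpha>}" using insert.prems by (auto simp: pairs_def)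
    obtain \<sigma> where \<sigma>: "\<sigma> \<in> carrier (galois_group \<phi>)"
      "\<And>x. root x \<Longrightarrow> \<sigma> x = (if {x, inverse x} \<in> V then inverse x else x)" using insert by auto
    obtain \<tau> where \<tau>: "\<tau> \<in> carrier (galois_group \<phi>)" "\<tau> \<alpha> = inverse \<alpha>" "\<tau> (inverse \<alpha>) = \<alpha>"
      "\<And>x. root x \<Longrightarrow> x \<noteq> \<alpha> \<Longrightarrow> x \<noteq> inverse \<alpha> \<Longrightarrow> \<tau> x = x" using transposition[OF \<alpha>(1)] by blast
    \<comment> \<open>\<open>\<tau>\<close> acts first. On the new pair \<open>c\<close> it swaps,
      and \<open>\<sigma>\<close> then fixes, as \<open>c\<close> is not in
      \<open>V\<close>.\<close>
    have "(\<sigma> \<circ> \<tau>) x = (if {x, inverse x} \<in> insert c V then inverse x else x)" if x: "root x" for x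
    proof (cases "{x, inverse x} = c")
      case True
      then have "x = \<alpha> \<or> x = inverse \<alpha>" unfolding \<alpha>(2) reciprocal_pair_set_eq_iff .
      then have "\<tau> x = inverse x" using \<tau>(2,3) by auto
      moreover have "{inverse x, inverse (inverse x)} = c" using True by auto
      ultimately show ?thesis using \<sigma>(2)[OF root_inverse[OF x]] True insert.hyps by auto
    next
      case False
      then have "\<tau> x = x" using \<tau>(4)[OF x] \<alpha>(2) reciprocal_pair_set_eq_iff[of x \<alpha>] by auto
      then show ?thesis using \<sigma>(2)[OF x] False by simp
    qed
    then show ?case using galois_comp[OF \<sigma>(1) \<tau>(1)] by blast
  qed
qed

text \<open>The kernel of the action on \<open>pairs\<close>: automorphisms preserve inversion, so
  \<open>{x, inverse x}\<close> is mapped to itself exactly when \<open>x\<close> goes to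
  \<open>x\<close> or to its inverse.\<close>

definition kernel_on_pairs :: "('l \<Rightarrow> 'l) set" where
  "kernel_on_pairs = {\<sigma> \<in> carrier (galois_group \<phi>). \<forall>x. root x \<longrightarrow> \<sigma> x = x \<or> \<sigma> x = inverse x}"

lemma kernel_on_pairsD:
  assumes "\<sigma> \<in> kernel_on_pairs"
  shows "\<sigma> \<in> carrier (galois_group \<phi>)" "root x \<Longrightarrow> \<sigma> x = x \<or> \<sigma> x = inverse x"
  using assms by (auto simp: kernel_on_pairs_def)

lemma kernel_involution:
  assumes "\<sigma> \<in> kernel_on_pairs"
  shows "\<sigma> \<circ> \<sigma> = id"
proof (rule galois_eqI)
  note \<sigma> = kernel_on_pairsD[OF assms]
  show "\<sigma> \<circ> \<sigma> \<in> carrier (galois_group \<phi>)" using galois_comp \<sigma>(1) by blast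
  show "id \<in> carrier (galois_group \<phi>)" by (simp add: galois_group_def is_field_hom_def)
  show "(\<sigma> \<circ> \<sigma>) x = id x" if "root x" for x
    using \<sigma>(2)[OF that] galois_inverse[OF \<sigma>(1), of x] by auto
qed

text \<open>On each root both maps are the identity or inversion, which commute; faithfulness on the
  roots does the rest.\<close>

lemma kernel_commute:
  assumes "\<sigma> \<in> kernel_on_pairs" "\<tau> \<in> kernel_on_pairs"
  shows "\<sigma> \<circ> \<tau> = \<tau> \<circ> \<sigma>"
proof (rule galois_eqI)
  note \<sigma> = kernel_on_pairsD[OF assms(1)] and \<tau> = kernel_on_pairsD[OF assms(2)]
  show "\<sigma> \<circ> \<tau> \<in> carrier (galois_group \<phi>)" "\<tau> \<circ> \<sigma> \<in> carrier (galois_group \<phi>)"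
    using galois_comp \<sigma>(1) \<tau>(1) by blast+
  show "(\<sigma> \<circ> \<tau>) x = (\<tau> \<circ> \<sigma>) x" if "root x" for x
    using \<sigma>(2)[OF that] \<tau>(2)[OF that] galois_inverse[OF \<sigma>(1), of x] galois_inverse[OF \<tau>(1), of x] by auto
qed

lemma normal_kernel: "kernel_on_pairs \<lhd> galois_group \<phi>"
proof -
  let ?G = "galois_group \<phi>"
  interpret G: Group.group ?G by (rule group_galois_group)
  have mult: "x \<otimes>\<^bsub>?G\<^esub> y = x \<circ> y" and one: "\<one>\<^bsub>?G\<^esub> = id" for x y by (simp_all add: galois_group_def)
  have "subgroup kernel_on_pairs ?G"
  proof (rule G.subgroupI)
    show "kernel_on_pairs \<subseteq> carrier ?G" by (auto simp: kernel_on_pairs_def)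
    have "id \<in> kernel_on_pairs" using G.one_closed by (simp add: kernel_on_pairs_def one)
    then show "kernel_on_pairs \<noteq> {}" by blast
    show "inv\<^bsub>?G\<^esub> \<sigma> \<in> kernel_on_pairs" if "\<sigma> \<in> kernel_on_pairs" for \<sigma>
      using G.inv_equality[of \<sigma> \<sigma>] kernel_involution[OF that] kernel_on_pairsD(1)[OF that] that
      by (simp add: mult one)
    show "\<sigma> \<otimes>\<^bsub>?G\<^esub> \<tau> \<in> kernel_on_pairs" if st: "\<sigma> \<in> kernel_on_pairs" "\<tau> \<in> kernel_on_pairs" for \<sigma> \<tau>
    proof -
      note \<sigma> = kernel_on_pairsD[OF st(1)] and \<tau> = kernel_on_pairsD[OF st(2)]
      have "(\<sigma> \<circ> \<tau>) x = x \<or> (\<sigma> \<circ> \<tau>) x = inverse x" if "root x" for x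
        using \<sigma>(2)[OF that] \<tau>(2)[OF that] galois_inverse[OF \<sigma>(1), of x] by auto
      then show ?thesis using galois_comp[OF \<sigma>(1) \<tau>(1)] by (auto simp: mult kernel_on_pairs_def)
    qed
  qed
  moreover have "g \<otimes>\<^bsub>?G\<^esub> h \<otimes>\<^bsub>?G\<^esub> inv\<^bsub>?G\<^esub> g \<in> kernel_on_pairs"
    if g: "g \<in> carrier ?G" and h: "h \<in> kernel_on_pairs" for g h
  proof -
    define k where "k = inv\<^bsub>?G\<^esub> g"
    have k: "k \<in> carrier ?G" using g by (simp add: k_def)
    have gk: "g (k x) = x" for x
      using G.r_inv[OF g] by (simp add: mult one k_def fun_eq_iff)
    \<comment> \<open>The root \<open>k x\<close> goes to itself or its inverse under
      \<open>h\<close>, and \<open>g\<close> carries the result back to \<open>x\<close> or its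
      inverse.\<close>
    have "(g \<circ> h \<circ> k) x = x \<or> (g \<circ> h \<circ> k) x = inverse x" if "root x" for x
      using kernel_on_pairsD(2)[OF h galois_root[OF k that]] gk[of x] galois_inverse[OF g, of "k x"] by auto
    moreover have "g \<circ> h \<circ> k \<in> carrier ?G"
      using g k kernel_on_pairsD(1)[OF h] galois_comp by blast
    ultimately show ?thesis by (auto simp: mult kernel_on_pairs_def k_def)
  qed
  ultimately show ?thesis by (simp add: G.normal_inv_iff)
qed

text \<open>Kernel elements correspond to the sets of pairs they swap: \<open>pair_swaps\<close>
  realises each set, and values on the roots determine the automorphism.\<close>

lemma card_kernel: "card kernel_on_pairs = 2 ^ m"
proof -
  obtain s where s: "\<And>V. V \<subseteq> pairs \<Longrightarrow> s V \<in> carrier (galois_group \<phi>)"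
    "\<And>V x. V \<subseteq> pairs \<Longrightarrow> root x \<Longrightarrow> s V x = (if {x, inverse x} \<in> V then inverse x else x)"
    using pair_swaps by metis
  have "inj_on s (Pow pairs)"
  proof (rule inj_onI)
    fix V W assume VW: "V \<in> Pow pairs" "W \<in> Pow pairs" "s V = s W"
    \<comment> \<open>Injectivity rests on \<open>root_neq_inverse\<close>: swapping a pair differs
      from fixing it.\<close>
    have "{x, inverse x} \<in> V \<longleftrightarrow> {x, inverse x} \<in> W" if "root x" for x
      using s(2)[of V x] s(2)[of W x] VW that root_neq_inverse[OF that] by (auto split: if_splits)
    then show "V = W" using VW(1,2) by (auto simp: pairs_def)
  qed
  moreover have "kernel_on_pairs = s ` Pow pairs"
  proof
    show "s ` Pow pairs \<subseteq> kernel_on_pairs" using s by (auto simp: kernel_on_pairs_def)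
    show "kernel_on_pairs \<subseteq> s ` Pow pairs"
    proof
      fix \<sigma> assume "\<sigma> \<in> kernel_on_pairs"
      note \<sigma> = kernel_on_pairsD[OF this]
      define V where "V = {{x, inverse x} |x. root x \<and> \<sigma> x \<noteq> x}"
      have V: "V \<subseteq> pairs" by (auto simp: V_def pairs_def)
      have "\<sigma> x = s V x" if x: "root x" for x
      proof -
        have "{x, inverse x} \<in> V \<longleftrightarrow> \<sigma> x \<noteq> x"
        proof
          assume "{x, inverse x} \<in> V"
          then obtain y where y: "{x, inverse x} = {y, inverse y}" "\<sigma> y \<noteq> y" by (auto simp: V_def)
          then have "x = y \<or> x = inverse y" by (simp add: reciprocal_pair_set_eq_iff)
          then show "\<sigma> x \<noteq> x" using y(2) galois_inverse[OF \<sigma>(1), of y] by auto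
        qed (use x in \<open>auto simp: V_def\<close>)
        then show ?thesis using s(2)[OF V x] \<sigma>(2)[OF x] by auto
      qed
      then have "\<sigma> = s V" using galois_eqI[OF \<sigma>(1) s(1)[OF V]] by blast
      then show "\<sigma> \<in> s ` Pow pairs" using V by blast
    qed
  qed
  moreover have "finite pairs" using finite_roots by (simp add: pairs_def)
  ultimately show ?thesis using card_pairs by (simp add: card_image card_Pow)
qed

end

theorem theorem5p2:
  fixes M :: "'a::{field,finite} poly" and m :: nat and gs :: "'a poly list"
    and \<phi> :: "'a poly fract \<Rightarrow> 'l::field"
  assumes "self_reciprocal M" and "degree M = 2 * m" and "poly M 0 = 1"
    and "M = [:-1, 1:] ^ 2 * prod_list gs"
    and "distinct gs"
    and "\<forall>g\<in>set gs. lead_coeff g = 1 \<and> irreducible g \<and> g \<noteq> [:-1, 1:] \<and> g \<noteq> [:1, 1:]"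
    and "is_splitting_field \<phi> (Mt M m)"
  shows "(\<forall>\<alpha>. poly (map_poly \<phi> (Mt M m)) \<alpha> = 0 \<longrightarrow>
            (\<exists>\<sigma>\<in>carrier (galois_group \<phi>). \<sigma> \<alpha> = inverse \<alpha> \<and> \<sigma> (inverse \<alpha>) = \<alpha> \<and>
               (\<forall>\<beta>. poly (map_poly \<phi> (Mt M m)) \<beta> = 0 \<and> \<beta> \<noteq> \<alpha> \<and> \<beta> \<noteq> inverse \<alpha> \<longrightarrow> \<sigma> \<beta> = \<beta>)))
       \<and> (\<exists>N. N \<lhd> galois_group \<phi> \<and> card N = 2 ^ m \<and>
               (\<forall>\<sigma>\<in>N. \<forall>\<tau>\<in>N. \<sigma> \<circ> \<tau> = \<tau> \<circ> \<sigma>) \<and> (\<forall>\<sigma>\<in>N. \<sigma> \<circ> \<sigma> = id))"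
proof -
  interpret reciprocal_family M m gs \<phi>
    by unfold_locales (use assms in auto)
  \<comment> \<open>\<open>kernel_on_pairs\<close> is the witness for \<open>N\<close>; it is
    elementary abelian because its elements commute and have square \<open>id\<close>.\<close>
  show ?thesis
    using transposition normal_kernel card_kernel kernel_commute kernel_involution by blast
qed

end
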